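(* Let $A\in \mathrm{M}_{n-1}\mathbb{R}$, let $\eta$ be one of the three matrices (a), (b), (c) of the context, and let $g_{A,\eta}$ be the corresponding Lorentzian metric on $\mathbb{R}^n$. Decompose $A$ as in the context, with $d\in\{0,1\}$ in case (c). Then $g_{A,\eta}$ is flat if and only if: (a) in case (a): $g_{A,\eta}$ is Ricci-flat; (b) in case (b): $g_{A,\eta}$ is Ricci-flat, $S_L^2=O$ and $\mathrm{rank}\,S_L\le 1$; (c) in case (c) with $d=0$: $g_{A,\eta}$ is Ricci-flat; in case (c) with $d=1$: $g_{A,\eta}$ is Ricci-flat, $S'=S'^2$ and $[S',T']=O$.
   Context: $\mathrm{M}_m\mathbb{R}$ is the set of real $m\times m$ matrices. Consider the following symmetric $n\times n$ matrices: (a) $\eta=\mathrm{Diag}(1,\dots,1,-1)$; (b) $\eta=\mathrm{Diag}(-1,1,\dots,1)$; (c) $\eta=I_{n-2}\oplus\begin{bmatrix}0&1\\1&0\end{bmatrix}$. For $A\in\mathrm{M}_{n-1}\mathbb{R}$, the metric $g_{A,\eta}$ on $\mathbb{R}^n$ with coordinates $x_1,\dots,x_n$ is $$g_{A,\eta}=d\bm{x}^T\begin{bmatrix} e^{-A^Tx_n}&\bm 0\\ \bm 0^T&1\end{bmatrix}\eta\begin{bmatrix} e^{-Ax_n}&\bm 0\\ \bm 0^T&1\end{bmatrix}d\bm{x},\qquad d\bm{x}=(dx_1,\dots,dx_n)^T.$$ It is the general left-invariant Lorentzian metric of a simply connected almost abelian Lie group (a group whose Lie algebra has basis $X_1,\dots,X_n$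 with $[X_i,X_j]=0$ and $[X_n,X_j]=\sum_i A^i_jX_i$ for $i,j\le n-1$). Flat means the curvature tensor vanishes; Ricci-flat means the Ricci tensor vanishes. Decompositions of $A$. Case (a): $A=S+T$ with $S$ symmetric and $T$ skew-symmetric. Case (b): with $J=\mathrm{Diag}(-1,1,\dots,1)\in\mathrm{M}_{n-1}\mathbb{R}$, $A=S_L+T_L$ is the unique decomposition with $S_L^T=JS_LJ$ and $T_L^T=-JT_LJ$. Case (c): $A=\begin{bmatrix}A'&\bm b\\ \bm c^T&d\end{bmatrix}$ with $A'\in\mathrm{M}_{n-2}\mathbb{R}$, $\bm b,\bm c\in\mathbb{R}^{n-2}$, $d\in\mathbb{R}$, and $A'=S'+T'$ with $S'$ symmetric and $T'$ skew-symmetric. In case (c), up to isometry one may always normalize $d\in\{0,1\}$. *)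

theory Defs
  imports
    "HOL-Analysis.Derivative"
    "Jordan_Normal_Form.Gauss_Jordan_Elimination"
    "Jordan_Normal_Form.DL_Rank"
begin

text \<open>Indices are 0-based: the coordinates \<open>x\<^sub>1, \<dots>, x\<^sub>n\<close> of a point of \<open>\<real>\<^sup>n\<close> are
  \<open>x $ 0, \<dots>, x $ (n - 1)\<close>. A metric on \<open>\<real>\<^sup>n\<close> is given by its matrix of components
  in the coordinates \<open>x\<^sub>1, \<dots>, x\<^sub>n\<close>, as a function of the point.\<close>

section \<open>Curvature of a pseudo-Riemannian metric on \<open>\<real>\<^sup>n\<close> in coordinates\<close>

definition partial_deriv :: "nat \<Rightarrow> nat \<Rightarrow> (real vec \<Rightarrow> real) \<Rightarrow> real vec \<Rightarrow> real" where
  "partial_deriv n k f x = deriv (\<lambda>t. f (x + t \<cdot>\<^sub>v unit_vec n k)) 0"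

text \<open>Components \<open>g\<^sup>i\<^sup>j\<close> of the inverse metric. The option \<^const>\<open>mat_inverse\<close> is a
  \<open>Some\<close> because a metric is nondegenerate.\<close>

definition inverse_metric :: "(real vec \<Rightarrow> real mat) \<Rightarrow> real vec \<Rightarrow> real mat" where
  "inverse_metric g x = the (mat_inverse (g x))"

text \<open>Christoffel symbols \<open>\<Gamma>\<^sup>i\<^sub>j\<^sub>k\<close> of the Levi-Civita connection.\<close>

definition christoffel ::
    "nat \<Rightarrow> (real vec \<Rightarrow> real mat) \<Rightarrow> nat \<Rightarrow> nat \<Rightarrow> nat \<Rightarrow> real vec \<Rightarrow> real" where
  "christoffel n g i j k x =
     (1/2) * (\<Sum>l<n. inverse_metric g x $$ (i, l) *
       (partial_deriv n j (\<lambda>y. g y $$ (l, k)) x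
        + partial_deriv n k (\<lambda>y. g y $$ (l, j)) x
        - partial_deriv n l (\<lambda>y. g y $$ (j, k)) x))"

text \<open>Components of the \<open>(1,3)\<close> curvature tensor
  \<open>R(X, Y) Z = \<nabla>\<^sub>X \<nabla>\<^sub>Y Z - \<nabla>\<^sub>Y \<nabla>\<^sub>X Z - \<nabla>\<^bsub>[X, Y]\<^esub> Z\<close>, with the index convention
  \<open>R(\<partial>\<^sub>k, \<partial>\<^sub>l) \<partial>\<^sub>j = \<Sum>\<^sub>i R\<^sup>i\<^sub>j\<^sub>k\<^sub>l \<partial>\<^sub>i\<close>.\<close>

definition riemann ::
    "nat \<Rightarrow> (real vec \<Rightarrow> real mat) \<Rightarrow> nat \<Rightarrow> nat \<Rightarrow> nat \<Rightarrow> nat \<Rightarrow> real vec \<Rightarrow> real" where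
  "riemann n g i j k l x =
     partial_deriv n k (christoffel n g i l j) x
     - partial_deriv n l (christoffel n g i k j) x
     + (\<Sum>m<n. christoffel n g i k m x * christoffel n g m l j x
               - christoffel n g i l m x * christoffel n g m k j x)"

text \<open>\<open>Ric(Y, Z)\<close> is the trace of \<open>X \<mapsto> R(X, Y) Z\<close>.\<close>

definition ricci :: "nat \<Rightarrow> (real vec \<Rightarrow> real mat) \<Rightarrow> nat \<Rightarrow> nat \<Rightarrow> real vec \<Rightarrow> real" where
  "ricci n g j l x = (\<Sum>i<n. riemann n g i j i l x)"

definition flat :: "nat \<Rightarrow> (real vec \<Rightarrow> real mat) \<Rightarrow> bool" where
  "flat n g \<longleftrightarrow> (\<forall>x \<in> carrier_vec n. \<forall>i<n. \<forall>j<n. \<forall>k<n. \<forall>l<n. riemann n g i j k l x = 0)"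

definition ricci_flat :: "nat \<Rightarrow> (real vec \<Rightarrow> real mat) \<Rightarrow> bool" where
  "ricci_flat n g \<longleftrightarrow> (\<forall>x \<in> carrier_vec n. \<forall>j<n. \<forall>l<n. ricci n g j l x = 0)"


section \<open>The metrics \<open>g\<^bsub>A,\<eta>\<^esub>\<close>\<close>

text \<open>The matrix exponential as an entrywise convergent series.\<close>

definition exp_mat :: "real mat \<Rightarrow> real mat" where
  "exp_mat A = mat (dim_row A) (dim_col A) (\<lambda>(i, j). \<Sum>k. (A ^\<^sub>m k) $$ (i, j) / fact k)"

definition almost_abelian_metric :: "nat \<Rightarrow> real mat \<Rightarrow> real mat \<Rightarrow> real vec \<Rightarrow> real mat" where
  "almost_abelian_metric n A \<eta> x =
     four_block_mat (exp_mat ((- (x $ (n - 1))) \<cdot>\<^sub>m transpose_mat A)) (0\<^sub>m (n - 1) 1)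
                    (0\<^sub>m 1 (n - 1)) (1\<^sub>m 1)
     * \<eta> *
     four_block_mat (exp_mat ((- (x $ (n - 1))) \<cdot>\<^sub>m A)) (0\<^sub>m (n - 1) 1)
                    (0\<^sub>m 1 (n - 1)) (1\<^sub>m 1)"

definition eta_a :: "nat \<Rightarrow> real mat" where
  "eta_a n = mat_diag n (\<lambda>i. if i = n - 1 then - 1 else 1)"

definition eta_b :: "nat \<Rightarrow> real mat" where
  "eta_b n = mat_diag n (\<lambda>i. if i = 0 then - 1 else 1)"

definition eta_c :: "nat \<Rightarrow> real mat" where
  "eta_c n = four_block_mat (1\<^sub>m (n - 2)) (0\<^sub>m (n - 2) 2)
                            (0\<^sub>m 2 (n - 2)) (mat_of_rows_list 2 [[0, 1], [1, 0]])"


section \<open>The decompositions of \<open>A\<close>\<close>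

definition sym_skew_decomp :: "nat \<Rightarrow> real mat \<Rightarrow> real mat \<Rightarrow> real mat \<Rightarrow> bool" where
  "sym_skew_decomp m A S T \<longleftrightarrow>
     S \<in> carrier_mat m m \<and> T \<in> carrier_mat m m \<and> A = S + T \<and>
     transpose_mat S = S \<and> transpose_mat T = - T"

definition lorentz_J :: "nat \<Rightarrow> real mat" where
  "lorentz_J m = mat_diag m (\<lambda>i. if i = 0 then - 1 else 1)"

definition lorentz_decomp :: "nat \<Rightarrow> real mat \<Rightarrow> real mat \<Rightarrow> real mat \<Rightarrow> bool" where
  "lorentz_decomp m A S T \<longleftrightarrow>
     S \<in> carrier_mat m m \<and> T \<in> carrier_mat m m \<and> A = S + T \<and>
     transpose_mat S = lorentz_J m * S * lorentz_J m \<and>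
     transpose_mat T = - (lorentz_J m * T * lorentz_J m)"

text \<open>The block matrix with rows \<open>(A', b)\<close> and \<open>(c\<^sup>T, d)\<close>, for \<open>A'\<close> of size \<open>m \<times> m\<close>.\<close>

definition bordered_mat :: "nat \<Rightarrow> real mat \<Rightarrow> real vec \<Rightarrow> real vec \<Rightarrow> real \<Rightarrow> real mat" where
  "bordered_mat m A' b c d =
     four_block_mat A' (mat_of_cols m [b]) (mat_of_rows m [c]) (mat_of_rows_list 1 [[d]])"

definition commutator_mat :: "real mat \<Rightarrow> real mat \<Rightarrow> real mat" where
  "commutator_mat X Y = X * Y - Y * X"

end

theory Submission
  imports Defs "Jordan_Normal_Form.DL_Rank_Submatrix"
begin

text \<open>In the coframe \<open>e\<^bsup>-A x\<^sub>n\<^esup> dx\<close> the metric has the constant matrix \<open>\<eta>\<close>, and the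
  Christoffel symbols and the curvature at any point are the values at the origin transported by the
  coframe. Flatness is therefore the vanishing of finitely many constants that are quadratic in \<open>A\<close>.
  In cases (a) and (b) they vanish iff \<open>S\<^sup>2 = [T, S]\<close> and all \<open>2 \<times> 2\<close> minors of \<open>S\<close> are zero;
  Ricci-flatness gives \<open>tr S\<^sup>2 = 0\<close>, which kills \<open>S\<close> when \<open>S\<close> is symmetric, and vanishing minors
  give \<open>S\<^sup>2 = (tr S) S\<close>. In case (c) Ricci-flatness forces \<open>b = 0\<close>, after which the curvature is
  \<open>Q = d S' - S'\<^sup>2 + [T', S']\<close>, with Ricci curvature \<open>tr Q\<close>. For \<open>d = 1\<close>, \<open>Q = 0\<close> makes
  \<open>X = S' - S'\<^sup>2\<close> a commutator \<open>[S', T']\<close>, and since \<open>X\<close> commutes with \<open>S'\<close> this gives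
  \<open>tr X\<^sup>2 = 0\<close>, hence \<open>X = 0\<close>.\<close>

section \<open>The matrix exponential\<close>

lemma pow_mat_smult:
  fixes A :: "real mat"
  assumes A: "A \<in> carrier_mat m m"
  shows "(t \<cdot>\<^sub>m A) ^\<^sub>m k = t ^ k \<cdot>\<^sub>m (A ^\<^sub>m k)"
proof (induction k)
  case 0
  then show ?case using A by (intro eq_matI) auto
next
  case (Suc k)
  have P: "A ^\<^sub>m k \<in> carrier_mat m m" using A by (rule pow_carrier_mat)
  show ?case
    using A P Suc
    by (intro eq_matI)
      (auto simp: mult_smult_assoc_mat[of _ m m _ m] mult_smult_distrib[of _ m m _ m])
qed

lemma pow_mat_Suc_entry:
  fixes A :: "real mat"
  assumes "A \<in> carrier_mat m m" "i < m" "j < m"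
  shows "(A ^\<^sub>m Suc k) $$ (i, j) = (\<Sum>c<m. (A ^\<^sub>m k) $$ (i, c) * A $$ (c, j))"
  using assms pow_carrier_mat[OF assms(1), of k]
  by (simp add: scalar_prod_def lessThan_atLeast0)

lemma pow_mat_Suc_entry_left:
  fixes A :: "real mat"
  assumes "A \<in> carrier_mat m m" "i < m" "j < m"
  shows "(A ^\<^sub>m Suc k) $$ (i, j) = (\<Sum>c<m. A $$ (i, c) * (A ^\<^sub>m k) $$ (c, j))"
proof -
  have P: "A ^\<^sub>m k \<in> carrier_mat m m" using assms(1) by (rule pow_carrier_mat)
  have "A ^\<^sub>m Suc k = A * A ^\<^sub>m k"
  proof (induction k)
    case 0
    then show ?case using assms(1) by simp
  next
    case (Suc k)
    have Q: "A ^\<^sub>m k \<in> carrier_mat m m" using assms(1) by (rule pow_carrier_mat)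
    have "A ^\<^sub>m Suc (Suc k) = (A * A ^\<^sub>m k) * A"
      using Suc by simp
    also have "\<dots> = A * (A ^\<^sub>m k * A)"
      using assms(1) Q by (simp add: assoc_mult_mat[of _ m m _ m _ m])
    finally show ?case by simp
  qed
  then show ?thesis
    using assms P by (simp add: scalar_prod_def lessThan_atLeast0)
qed

text \<open>The sum \<open>K\<close> of all absolute entries dominates every column sum, so each
  further factor \<open>A\<close> costs at most a factor \<open>K\<close>. This makes the entry
  series of the exponential converge for all \<open>t\<close>.\<close>

lemma pow_mat_entry_bound:
  fixes A :: "real mat"
  assumes A: "A \<in> carrier_mat m m"
  obtains K where "\<And>k i j. i < m \<Longrightarrow> j < m \<Longrightarrow> \<bar>(A ^\<^sub>m k) $$ (i, j)\<bar> \<le> K ^ k"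
proof -
  define K where "K = (\<Sum>i<m. \<Sum>j<m. \<bar>A $$ (i, j)\<bar>)"
  have "\<bar>(A ^\<^sub>m k) $$ (i, j)\<bar> \<le> K ^ k" if "i < m" "j < m" for k i j
    using that
  proof (induction k arbitrary: i j)
    case 0
    then show ?case using A by simp
  next
    case (Suc k)
    have "\<bar>(A ^\<^sub>m Suc k) $$ (i, j)\<bar> \<le> (\<Sum>c<m. \<bar>(A ^\<^sub>m k) $$ (i, c)\<bar> * \<bar>A $$ (c, j)\<bar>)"
      unfolding pow_mat_Suc_entry[OF A Suc.prems] abs_mult[symmetric] by (rule sum_abs)
    also have "\<dots> \<le> (\<Sum>c<m. K ^ k * \<bar>A $$ (c, j)\<bar>)"
      using Suc by (intro sum_mono mult_right_mono) auto
    also have "\<dots> = K ^ k * (\<Sum>c<m. \<bar>A $$ (c, j)\<bar>)"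
      by (simp add: sum_distrib_left)
    also have "\<dots> \<le> K ^ k * K"
    proof (intro mult_left_mono)
      show "(\<Sum>c<m. \<bar>A $$ (c, j)\<bar>) \<le> K"
        unfolding K_def using Suc.prems
        by (intro sum_mono member_le_sum) auto
      show "0 \<le> K ^ k" unfolding K_def by (intro zero_le_power sum_nonneg) auto
    qed
    finally show ?case by (simp add: mult.commute)
  qed
  then show thesis by (rule that)
qed

text \<open>Pulling the powers of \<open>t\<close> out of the matrix powers leaves a power series in
  \<open>t\<close>, to which termwise differentiation applies.\<close>

lemma exp_mat_entry:
  assumes "A \<in> carrier_mat m m" "i < m" "j < m"
  shows "exp_mat (t \<cdot>\<^sub>m A) $$ (i, j) = (\<Sum>k. (A ^\<^sub>m k) $$ (i, j) / fact k * t ^ k)"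
proof -
  have "A ^\<^sub>m k \<in> carrier_mat m m" for k using assms(1) by (rule pow_carrier_mat)
  then show ?thesis
    using assms by (simp add: exp_mat_def pow_mat_smult[OF assms(1)] mult.commute)
qed

lemma exp_mat_summable:
  assumes A: "A \<in> carrier_mat m m" and ij: "i < m" "j < m"
  shows "summable (\<lambda>k. (A ^\<^sub>m k) $$ (i, j) / fact k * (t :: real) ^ k)"
proof -
  obtain K where K: "\<And>k i j. i < m \<Longrightarrow> j < m \<Longrightarrow> \<bar>(A ^\<^sub>m k) $$ (i, j)\<bar> \<le> K ^ k"
    using pow_mat_entry_bound[OF A] by blast
  show ?thesis
  proof (rule summable_comparison_test)
    show "summable (\<lambda>k. inverse (fact k) * (K * \<bar>t\<bar>) ^ k)"
      by (rule summable_exp)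
    show "\<exists>N. \<forall>k\<ge>N. norm ((A ^\<^sub>m k) $$ (i, j) / fact k * t ^ k)
            \<le> inverse (fact k) * (K * \<bar>t\<bar>) ^ k"
    proof (intro exI[of _ 0] allI impI)
      fix k :: nat
      have "norm ((A ^\<^sub>m k) $$ (i, j) / fact k * t ^ k)
          = \<bar>(A ^\<^sub>m k) $$ (i, j)\<bar> * (inverse (fact k) * \<bar>t\<bar> ^ k)"
        by (simp add: abs_mult power_abs divide_inverse)
      also have "\<dots> \<le> K ^ k * (inverse (fact k) * \<bar>t\<bar> ^ k)"
        using K[OF ij] by (intro mult_right_mono) auto
      finally show "norm ((A ^\<^sub>m k) $$ (i, j) / fact k * t ^ k)
          \<le> inverse (fact k) * (K * \<bar>t\<bar>) ^ k"
        by (simp add: power_mult_distrib mult_ac)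
    qed
  qed
qed

lemma exp_mat_deriv_series:
  assumes A: "A \<in> carrier_mat m m" and ij: "i < m" "j < m"
  shows "((\<lambda>t. exp_mat (t \<cdot>\<^sub>m A) $$ (i, j)) has_real_derivative
      (\<Sum>k. (A ^\<^sub>m Suc k) $$ (i, j) / fact k * t ^ k)) (at t)"
proof -
  let ?c = "\<lambda>k. (A ^\<^sub>m k) $$ (i, j) / fact k"
  have "((\<lambda>t. \<Sum>k. ?c k * t ^ k) has_real_derivative (\<Sum>k. diffs ?c k * t ^ k)) (at t)"
    by (rule termdiffs_strong_converges_everywhere) (rule exp_mat_summable[OF A ij])
  moreover have "diffs ?c = (\<lambda>k. (A ^\<^sub>m Suc k) $$ (i, j) / fact k)"
    by (auto simp: diffs_def fun_eq_iff divide_simps simp del: pow_mat.simps)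
  ultimately show ?thesis
    unfolding exp_mat_entry[OF A ij] by simp
qed

lemma exp_mat_deriv:
  assumes A: "A \<in> carrier_mat m m" and ij: "i < m" "j < m"
  shows "((\<lambda>t. exp_mat (t \<cdot>\<^sub>m A) $$ (i, j)) has_real_derivative
      (\<Sum>c<m. exp_mat (t \<cdot>\<^sub>m A) $$ (i, c) * A $$ (c, j))) (at t)"
proof -
  have "(\<Sum>k. (A ^\<^sub>m Suc k) $$ (i, j) / fact k * t ^ k)
      = (\<Sum>k. \<Sum>c<m. (A ^\<^sub>m k) $$ (i, c) / fact k * t ^ k * A $$ (c, j))"
    unfolding pow_mat_Suc_entry[OF A ij]
    by (simp add: divide_inverse sum_distrib_left sum_distrib_right mult_ac)
  also have "\<dots> = (\<Sum>c<m. \<Sum>k. (A ^\<^sub>m k) $$ (i, c) / fact k * t ^ k * A $$ (c, j))"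
    using ij by (intro suminf_sum summable_mult2 exp_mat_summable[OF A]) auto
  also have "\<dots> = (\<Sum>c<m. exp_mat (t \<cdot>\<^sub>m A) $$ (i, c) * A $$ (c, j))"
  proof (intro sum.cong refl)
    fix c assume "c \<in> {..<m}"
    then have "c < m" by simp
    then show "(\<Sum>k. (A ^\<^sub>m k) $$ (i, c) / fact k * t ^ k * A $$ (c, j))
        = exp_mat (t \<cdot>\<^sub>m A) $$ (i, c) * A $$ (c, j)"
      unfolding exp_mat_entry[OF A ij(1) \<open>c < m\<close>]
      by (intro suminf_mult2[symmetric] exp_mat_summable[OF A ij(1)])
  qed
  finally show ?thesis using exp_mat_deriv_series[OF A ij, of t] by (simp only:)
qed

text \<open>Splitting off the first factor of a power instead of the last puts \<open>A\<close> on
  the left. Both forms are wanted: the coframe satisfies the left equation, its inverse the right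
  one.\<close>

lemma exp_mat_deriv_left:
  assumes A: "A \<in> carrier_mat m m" and ij: "i < m" "j < m"
  shows "((\<lambda>t. exp_mat (t \<cdot>\<^sub>m A) $$ (i, j)) has_real_derivative
      (\<Sum>c<m. A $$ (i, c) * exp_mat (t \<cdot>\<^sub>m A) $$ (c, j))) (at t)"
proof -
  have "(\<Sum>k. (A ^\<^sub>m Suc k) $$ (i, j) / fact k * t ^ k)
      = (\<Sum>k. \<Sum>c<m. A $$ (i, c) * ((A ^\<^sub>m k) $$ (c, j) / fact k * t ^ k))"
    unfolding pow_mat_Suc_entry_left[OF A ij]
    by (simp add: divide_inverse sum_distrib_left sum_distrib_right mult_ac)
  also have "\<dots> = (\<Sum>c<m. \<Sum>k. A $$ (i, c) * ((A ^\<^sub>m k) $$ (c, j) / fact k * t ^ k))"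
    using ij by (intro suminf_sum summable_mult exp_mat_summable[OF A]) auto
  also have "\<dots> = (\<Sum>c<m. A $$ (i, c) * exp_mat (t \<cdot>\<^sub>m A) $$ (c, j))"
  proof (intro sum.cong refl)
    fix c assume "c \<in> {..<m}"
    then have "c < m" by simp
    then show "(\<Sum>k. A $$ (i, c) * ((A ^\<^sub>m k) $$ (c, j) / fact k * t ^ k))
        = A $$ (i, c) * exp_mat (t \<cdot>\<^sub>m A) $$ (c, j)"
      unfolding exp_mat_entry[OF A \<open>c < m\<close> ij(2)]
      by (intro suminf_mult exp_mat_summable[OF A _ ij(2)])
  qed
  finally show ?thesis using exp_mat_deriv_series[OF A ij, of t] by (simp only:)
qed

lemma exp_mat_0:
  assumes A: "A \<in> carrier_mat m m" and ij: "i < m" "j < m"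
  shows "exp_mat (0 \<cdot>\<^sub>m A) $$ (i, j) = (if i = j then 1 else 0)"
  unfolding exp_mat_entry[OF A ij] powser_zero using assms by simp

lemma exp_mat_transpose:
  assumes A: "A \<in> carrier_mat m m" and ij: "i < m" "j < m"
  shows "exp_mat (t \<cdot>\<^sub>m transpose_mat A) $$ (i, j) = exp_mat (t \<cdot>\<^sub>m A) $$ (j, i)"
proof -
  have AT: "transpose_mat A \<in> carrier_mat m m" using A by simp
  have "(transpose_mat A ^\<^sub>m k) $$ (i, j) = (A ^\<^sub>m k) $$ (j, i)" for k
    using ij
  proof (induction k arbitrary: i j)
    case 0
    then show ?case using A by auto
  next
    case (Suc k)
    then show ?case
      using A by (simp add: pow_mat_Suc_entry[OF AT] pow_mat_Suc_entry_left[OF A] mult.commute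
          del: pow_mat.simps)
  qed
  then show ?thesis by (simp add: exp_mat_entry[OF A] exp_mat_entry[OF AT] ij)
qed

text \<open>The derivative of \<open>E(t) E(-t)\<close> is
  \<open>E(t) A E(-t) - E(t) A E(-t) = 0\<close>, with the right form of the derivative for the
  first factor and the left form for the second. The constant value is read off at
  \<open>0\<close>.\<close>

lemma exp_mat_inverse:
  assumes A: "A \<in> carrier_mat m m" and ij: "i < m" "j < m"
  shows "(\<Sum>c<m. exp_mat (t \<cdot>\<^sub>m A) $$ (i, c) * exp_mat ((- t) \<cdot>\<^sub>m A) $$ (c, j))
      = (if i = j then 1 else 0)"
proof -
  let ?E = "\<lambda>t i j. exp_mat (t \<cdot>\<^sub>m A) $$ (i, j)"
  let ?f = "\<lambda>t. \<Sum>c<m. ?E t i c * ?E (- t) c j"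
  have "(?f has_real_derivative 0) (at t)" for t
  proof -
    have neg: "((\<lambda>t. ?E (- t) c j) has_real_derivative - (\<Sum>d<m. A $$ (c, d) * ?E (- t) d j)) (at t)"
      if "c < m" for c
      using DERIV_chain2[OF exp_mat_deriv_left[OF A that ij(2)] DERIV_minus[OF DERIV_ident]] by simp
    have "(?f has_real_derivative
        (\<Sum>c<m. (\<Sum>d<m. ?E t i d * A $$ (d, c)) * ?E (- t) c j
              + - (\<Sum>d<m. A $$ (c, d) * ?E (- t) d j) * ?E t i c)) (at t)"
      by (intro DERIV_sum DERIV_mult exp_mat_deriv[OF A] neg) (use ij in auto)
    moreover have "(\<Sum>c<m. (\<Sum>d<m. ?E t i d * A $$ (d, c)) * ?E (- t) c j)
        = (\<Sum>c<m. (\<Sum>d<m. A $$ (c, d) * ?E (- t) d j) * ?E t i c)"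
      unfolding sum_distrib_right by (subst sum.swap) (simp add: mult_ac)
    ultimately show ?thesis by (simp add: sum_subtractf)
  qed
  then have "?f t = ?f 0" by (rule DERIV_isconst_all[rule_format, rotated])
  also have "\<dots> = (if i = j then 1 else 0)"
    using ij by (simp add: exp_mat_0[OF A] if_distrib[of "\<lambda>x. x * _"] cong: if_cong)
  finally show ?thesis .
qed

declare One_nat_def [simp del]

section \<open>Square matrices as functions of two indices\<close>

text \<open>With total functions of two indices, associativity and distributivity hold without
  carrier conditions. Only entries below \<open>n\<close> are meaningful, so the rules for the
  identity \<open>kron\<close> carry index bounds.\<close>

definition mmul :: "nat \<Rightarrow> (nat \<Rightarrow> nat \<Rightarrow> real) \<Rightarrow> (nat \<Rightarrow> nat \<Rightarrow> real) \<Rightarrow> nat \<Rightarrow> nat \<Rightarrow> real" where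
  "mmul n X Y i j = (\<Sum>c<n. X i c * Y c j)"

definition kron :: "nat \<Rightarrow> nat \<Rightarrow> real" where
  "kron i j = (if i = j then 1 else 0)"

definition mtransp :: "(nat \<Rightarrow> nat \<Rightarrow> real) \<Rightarrow> nat \<Rightarrow> nat \<Rightarrow> real" where
  "mtransp X i j = X j i"

lemma kron_sym: "kron i j = kron j i"
  by (simp add: kron_def)

lemma sum_kron_left: "k < n \<Longrightarrow> (\<Sum>c<n. kron k c * f c) = f k"
  by (simp add: kron_def if_distrib[of "\<lambda>x. x * _"] cong: if_cong)

lemma sum_kron_right: "k < n \<Longrightarrow> (\<Sum>c<n. f c * kron c k) = f k"
  by (simp add: kron_def if_distrib[of "\<lambda>x. _ * x"] cong: if_cong)

lemma mmul_kron_left: "i < n \<Longrightarrow> mmul n kron X i j = X i j"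
  by (simp add: mmul_def sum_kron_left)

lemma mmul_kron_right: "j < n \<Longrightarrow> mmul n X kron i j = X i j"
  by (simp add: mmul_def sum_kron_right)

lemma mmul_assoc: "mmul n (mmul n X Y) Z = mmul n X (mmul n Y Z)"
proof (intro ext)
  fix i j
  have "(\<Sum>c<n. (\<Sum>d<n. X i d * Y d c) * Z c j) = (\<Sum>c<n. \<Sum>d<n. X i d * Y d c * Z c j)"
    by (simp add: sum_distrib_right)
  also have "\<dots> = (\<Sum>d<n. \<Sum>c<n. X i d * Y d c * Z c j)"
    by (rule sum.swap)
  finally show "mmul n (mmul n X Y) Z i j = mmul n X (mmul n Y Z) i j"
    by (simp add: mmul_def sum_distrib_left mult_ac)
qed

lemma mmul_cong:
  assumes "\<And>c. c < n \<Longrightarrow> X i c = X' i c" "\<And>c. c < n \<Longrightarrow> Y c j = Y' c j"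
  shows "mmul n X Y i j = mmul n X' Y' i j"
  unfolding mmul_def using assms by (intro sum.cong) auto

lemma mtransp_mmul: "mtransp (mmul n X Y) = mmul n (mtransp Y) (mtransp X)"
  by (intro ext) (simp add: mtransp_def mmul_def mult.commute)

lemma mmul_add_left: "mmul n (\<lambda>i j. X i j + Y i j) Z i j = mmul n X Z i j + mmul n Y Z i j"
  by (simp add: mmul_def distrib_right sum.distrib)

lemma mmul_add_right: "mmul n Z (\<lambda>i j. X i j + Y i j) i j = mmul n Z X i j + mmul n Z Y i j"
  by (simp add: mmul_def distrib_left sum.distrib)

lemma mmul_diff_left: "mmul n (\<lambda>i j. X i j - Y i j) Z i j = mmul n X Z i j - mmul n Y Z i j"
  by (simp add: mmul_def left_diff_distrib sum_subtractf)

lemma mmul_diff_right: "mmul n Z (\<lambda>i j. X i j - Y i j) i j = mmul n Z X i j - mmul n Z Y i j"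
  by (simp add: mmul_def right_diff_distrib sum_subtractf)

lemma mmul_minus_left: "mmul n (\<lambda>i j. - X i j) Z i j = - mmul n X Z i j"
  by (simp add: mmul_def sum_negf)

lemma mmul_minus_right: "mmul n Z (\<lambda>i j. - X i j) i j = - mmul n Z X i j"
  by (simp add: mmul_def sum_negf)

lemma mmul_zero_left: "mmul n (\<lambda>i j. 0) Z i j = 0"
  by (simp add: mmul_def)

text \<open>\<open>Y Z = 1\<close> is known only for indices below \<open>n\<close>, so the inner
  factors cannot be rewritten as functions; the summation range of the outer products supplies the
  bounds.\<close>

lemma mmul_cancel_mid:
  assumes "\<And>c d. c < n \<Longrightarrow> d < n \<Longrightarrow> mmul n Y Z c d = kron c d"
  shows "mmul n (mmul n X Y) (mmul n Z W) i j = mmul n X W i j"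
proof -
  have "mmul n (mmul n X Y) (mmul n Z W) i j = mmul n X (mmul n (mmul n Y Z) W) i j"
    by (simp add: mmul_assoc)
  also have "\<dots> = mmul n X W i j"
  proof (intro mmul_cong refl)
    fix c assume c: "c < n"
    have "mmul n (mmul n Y Z) W c j = mmul n kron W c j"
      using assms c by (intro mmul_cong refl) auto
    then show "mmul n (mmul n Y Z) W c j = W c j"
      using c by (simp add: mmul_kron_left)
  qed
  finally show ?thesis .
qed

lemma mmul_deriv:
  assumes "\<And>c. c < n \<Longrightarrow> ((\<lambda>t. X t i c) has_real_derivative X' i c) (at t)"
    and "\<And>c. c < n \<Longrightarrow> ((\<lambda>t. Y t c j) has_real_derivative Y' c j) (at t)"
  shows "((\<lambda>t. mmul n (X t) (Y t) i j) has_real_derivative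
      mmul n X' (Y t) i j + mmul n (X t) Y' i j) (at t)"
proof -
  have "((\<lambda>t. \<Sum>c<n. X t i c * Y t c j) has_real_derivative
      (\<Sum>c<n. X' i c * Y t c j + Y' c j * X t i c)) (at t)"
    using assms by (intro DERIV_sum DERIV_mult) auto
  then show ?thesis
    by (simp add: mmul_def sum.distrib mult_ac)
qed

text \<open>Moves \<open>X\<close> from the coefficients to the contracted family \<open>f\<close>.
  This turns the \<open>- Ah F\<close> in the derivative of the coframe into the last term of
  \<open>rho\<close>.\<close>

lemma sum_mmul_swap:
  "(\<Sum>b<n. mmul n X Y b l * f b) = (\<Sum>b<n. Y b l * (\<Sum>c<n. X c b * f c))"
proof -
  have "(\<Sum>b<n. mmul n X Y b l * f b) = (\<Sum>b<n. \<Sum>c<n. X b c * Y c l * f b)"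
    by (simp add: mmul_def sum_distrib_right)
  also have "\<dots> = (\<Sum>c<n. \<Sum>b<n. X b c * Y c l * f b)"
    by (rule sum.swap)
  finally show ?thesis by (simp add: sum_distrib_left mult_ac)
qed

text \<open>Chain rule along the line through \<open>x\<close> in direction \<open>k\<close>, on
  which the last coordinate moves with speed \<open>kron (n - 1) k\<close>. The line stays in
  \<open>carrier_vec n\<close>, so agreement of \<open>f\<close> with \<open>\<phi>\<close> there
  suffices.\<close>

lemma partial_deriv_last_coord:
  fixes x :: "real vec"
  assumes x: "x \<in> carrier_vec n" and "k < n" "0 < n"
    and f: "\<And>y. y \<in> carrier_vec n \<Longrightarrow> f y = \<phi> (y $ (n - 1))"
    and d: "(\<phi> has_real_derivative d) (at (x $ (n - 1)))"
  shows "partial_deriv n k f x = kron (n - 1) k * d"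
proof -
  have *: "(x + t \<cdot>\<^sub>v unit_vec n k) $ (n - 1) = x $ (n - 1) + t * kron (n - 1) k" for t
    using assms(1-3) by (auto simp: kron_def)
  have eq: "(\<lambda>t. f (x + t \<cdot>\<^sub>v unit_vec n k)) = (\<lambda>t. \<phi> (x $ (n - 1) + t * kron (n - 1) k))"
    using x by (subst f) (auto simp: *)
  have "((\<lambda>t. x $ (n - 1) + t * kron (n - 1) k) has_real_derivative kron (n - 1) k) (at 0)"
    by (auto intro!: derivative_eq_intros)
  then have "((\<lambda>t. \<phi> (x $ (n - 1) + t * kron (n - 1) k)) has_real_derivative
      d * kron (n - 1) k) (at 0)"
    using d by (intro DERIV_chain2[of \<phi>]) auto
  then show ?thesis
    unfolding partial_deriv_def eq by (simp add: DERIV_imp_deriv mult.commute)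
qed

lemma mat_mult_entry:
  assumes "X \<in> carrier_mat n n" "Y \<in> carrier_mat n n" "i < n" "j < n"
  shows "(X * Y :: real mat) $$ (i, j) = mmul n (\<lambda>i j. X $$ (i, j)) (\<lambda>i j. Y $$ (i, j)) i j"
  using assms by (simp add: mmul_def scalar_prod_def lessThan_atLeast0)

text \<open>A two-sided inverse rules out \<open>None\<close>, and the matrix returned in the other
  case is a left inverse, hence equal to \<open>Y\<close>.\<close>

lemma mat_inverse_eqI:
  fixes X Y :: "real mat"
  assumes X: "X \<in> carrier_mat n n" and Y: "Y \<in> carrier_mat n n"
    and XY: "X * Y = 1\<^sub>m n" and YX: "Y * X = 1\<^sub>m n"
  shows "the (mat_inverse X) = Y"
proof (cases "mat_inverse X")
  case None
  have "X \<in> Units (ring_mat TYPE(real) n ())"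
    using X Y XY YX by (auto simp: Units_def ring_mat_simps)
  with mat_inverse(1)[OF X None, of "()"] show ?thesis by simp
next
  case (Some Z)
  have Z: "Z * X = 1\<^sub>m n" "Z \<in> carrier_mat n n"
    using mat_inverse(2)[OF X Some] by auto
  have "Z = Z * (X * Y)" using Z XY by simp
  also have "\<dots> = (Z * X) * Y" using assoc_mult_mat[OF Z(2) X Y] by (rule sym)
  finally show ?thesis using Z Y Some by simp
qed

section \<open>Curvature in terms of a coframe depending on one coordinate\<close>

text \<open>\<open>F\<close> stands for the exponential of \<open>- t A\<close> bordered by a
  \<open>1\<close>, \<open>H\<close> for its inverse, and \<open>Ah\<close> for \<open>A\<close>
  bordered by zeros. The curvature computation uses only these equations, so the three choices of
  \<open>eta\<close> are treated at once.\<close>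

locale exp_coframe =
  fixes n :: nat and eta Ah :: "nat \<Rightarrow> nat \<Rightarrow> real"
    and F H :: "real \<Rightarrow> nat \<Rightarrow> nat \<Rightarrow> real" and g :: "real vec \<Rightarrow> real mat"
  assumes n_pos: "0 < n"
    and F_deriv: "\<And>i j t. i < n \<Longrightarrow> j < n \<Longrightarrow>
      ((\<lambda>t. F t i j) has_real_derivative - mmul n Ah (F t) i j) (at t)"
    and H_deriv: "\<And>i j t. i < n \<Longrightarrow> j < n \<Longrightarrow>
      ((\<lambda>t. H t i j) has_real_derivative mmul n (H t) Ah i j) (at t)"
    and HF: "\<And>i j t. i < n \<Longrightarrow> j < n \<Longrightarrow> mmul n (H t) (F t) i j = kron i j"
    and FH: "\<And>i j t. i < n \<Longrightarrow> j < n \<Longrightarrow> mmul n (F t) (H t) i j = kron i j"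
    and F_last: "\<And>j t. j < n \<Longrightarrow> F t (n - 1) j = kron (n - 1) j"
    and F_0: "\<And>i j. i < n \<Longrightarrow> j < n \<Longrightarrow> F 0 i j = kron i j"
    and eta_sym: "\<And>i j. eta i j = eta j i"
    and eta_sq: "\<And>i j. i < n \<Longrightarrow> j < n \<Longrightarrow> mmul n eta eta i j = kron i j"
    and g_carrier: "\<And>x. g x \<in> carrier_mat n n"
    and g_entry: "\<And>(x :: real vec) i j. i < n \<Longrightarrow> j < n \<Longrightarrow>
      g x $$ (i, j) = mmul n (mtransp (F (x $ (n - 1)))) (mmul n eta (F (x $ (n - 1)))) i j"
begin

abbreviation N :: nat where "N \<equiv> n - 1"

text \<open>Minus the derivative of the metric along the last coordinate at the origin. In
  \<open>M\<close> one index of it is raised, \<open>eta\<close> being its own inverse.\<close>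

definition B :: "nat \<Rightarrow> nat \<Rightarrow> real" where
  "B i j = mmul n (mtransp Ah) eta i j + mmul n eta Ah i j"

definition M :: "nat \<Rightarrow> nat \<Rightarrow> real" where
  "M = mmul n eta B"

text \<open>The Christoffel symbols at the origin, with the upper index in second position.\<close>

definition D :: "nat \<Rightarrow> nat \<Rightarrow> nat \<Rightarrow> real" where
  "D b a c = - (1/2) * (kron N b * M a c + kron N c * M a b - eta a N * B b c)"

text \<open>The endomorphism \<open>R0 a b\<close> is the curvature \<open>R(\<partial>\<^sub>a, \<partial>\<^sub>b)\<close> at the origin;
  the term \<open>rho b\<close> collects the derivative of the connection form along the last coordinate.\<close>

definition rho :: "nat \<Rightarrow> nat \<Rightarrow> nat \<Rightarrow> real" where
  "rho b i j = mmul n Ah (D b) i j - mmul n (D b) Ah i j - (\<Sum>c<n. Ah c b * D c i j)"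

definition R0 :: "nat \<Rightarrow> nat \<Rightarrow> nat \<Rightarrow> nat \<Rightarrow> real" where
  "R0 a b i j = kron N a * rho b i j - kron N b * rho a i j
     + (mmul n (D a) (D b) i j - mmul n (D b) (D a) i j)"

text \<open>The form \<open>B\<close> with both lower indices transported from the origin to the
  points with last coordinate \<open>t\<close>.\<close>

definition K :: "real \<Rightarrow> nat \<Rightarrow> nat \<Rightarrow> real" where
  "K t = mmul n (mtransp (F t)) (mmul n B (F t))"

text \<open>The corresponding transport of an endomorphism, which has one upper and one lower
  index.\<close>

definition sandwich :: "real \<Rightarrow> (nat \<Rightarrow> nat \<Rightarrow> real) \<Rightarrow> nat \<Rightarrow> nat \<Rightarrow> real" where
  "sandwich t X = mmul n (H t) (mmul n X (F t))"

lemma R0_antisym: "R0 b a i j = - R0 a b i j"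
  by (simp add: R0_def)

lemma R0_self: "R0 a a i j = 0"
  by (simp add: R0_def)

lemma N_less: "N < n" using n_pos by simp

lemma H_last: "j < n \<Longrightarrow> H t N j = kron N j"
  using FH[OF N_less, of j t] F_last N_less
  by (simp add: mmul_def sum_kron_left)

lemma H_0: "i < n \<Longrightarrow> j < n \<Longrightarrow> H 0 i j = kron i j"
  using HF[of i j 0] F_0 by (simp add: mmul_def sum_kron_right)

section \<open>First derivatives and inverse of the metric\<close>

lemma metric_deriv:
  assumes "i < n" "j < n"
  shows "((\<lambda>t. mmul n (mtransp (F t)) (mmul n eta (F t)) i j) has_real_derivative - K t i j) (at t)"
proof -
  have 1: "((\<lambda>t. mtransp (F t) i c) has_real_derivative - mmul n (mtransp (F t)) (mtransp Ah) i c) (at t)"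
    if "c < n" for c
    using F_deriv[OF that assms(1), of t]
    by (simp add: mtransp_def mmul_def mult.commute)
  have 2: "((\<lambda>t. mmul n eta (F t) c j) has_real_derivative - mmul n eta (mmul n Ah (F t)) c j) (at t)"
    if "c < n" for c
    using mmul_deriv[of n "\<lambda>t. eta" c "\<lambda>i j. 0" t F j "\<lambda>i j. - mmul n Ah (F t) i j"]
      F_deriv assms by (simp add: mmul_zero_left mmul_minus_right)
  have "((\<lambda>t. mmul n (mtransp (F t)) (mmul n eta (F t)) i j) has_real_derivative
     mmul n (\<lambda>i j. - mmul n (mtransp (F t)) (mtransp Ah) i j) (mmul n eta (F t)) i j
     + mmul n (mtransp (F t)) (\<lambda>i j. - mmul n eta (mmul n Ah (F t)) i j) i j) (at t)"
    by (rule mmul_deriv) (use 1 2 in auto)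
  moreover have "mmul n B (F t) = (\<lambda>i j. mmul n (mtransp Ah) (mmul n eta (F t)) i j
      + mmul n eta (mmul n Ah (F t)) i j)"
    unfolding B_def[abs_def] by (intro ext) (simp add: mmul_add_left mmul_assoc)
  then have "K t i j = mmul n (mtransp (F t)) (mmul n (mtransp Ah) (mmul n eta (F t))) i j
     + mmul n (mtransp (F t)) (mmul n eta (mmul n Ah (F t))) i j"
    by (simp add: K_def mmul_add_right)
  ultimately show ?thesis
    by (simp add: mmul_minus_left mmul_minus_right mmul_assoc)
qed

lemma partial_deriv_metric:
  assumes "x \<in> carrier_vec n" "i < n" "j < n" "k < n"
  shows "partial_deriv n k (\<lambda>y. g y $$ (i, j)) x = - kron N k * K (x $ N) i j"
  using partial_deriv_last_coord[OF assms(1,4) n_pos g_entry[OF assms(2,3)] metric_deriv[OF assms(2,3)]]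
  by simp

text \<open>The inverse of \<open>F^T eta F\<close> is \<open>H eta H^T\<close>: in either product
  the mutually inverse factors meet in the middle and collapse one pair after the other.\<close>

lemma inverse_metric_entry:
  assumes "i < n" "j < n"
  shows "inverse_metric g x $$ (i, j) = mmul n (H (x $ N)) (mmul n eta (mtransp (H (x $ N)))) i j"
proof -
  define F' H' where "F' = F (x $ N)" and "H' = H (x $ N)"
  define G where "G = mat n n (\<lambda>(i, j). mmul n H' (mmul n eta (mtransp H')) i j)"
  have FH': "mmul n F' H' c d = kron c d" and HF': "mmul n H' F' c d = kron c d"
    if "c < n" "d < n" for c d
    using FH HF that by (auto simp: F'_def H'_def)
  have FHt: "mmul n (mtransp H') (mtransp F') c d = kron c d" if "c < n" "d < n" for c d
    using FH'[OF that(2,1)] by (simp add: mtransp_mmul[symmetric] mtransp_def kron_sym)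
  have HFt: "mmul n (mtransp F') (mtransp H') c d = kron c d" if "c < n" "d < n" for c d
    using HF'[OF that(2,1)] by (simp add: mtransp_mmul[symmetric] mtransp_def kron_sym)
  have G: "G \<in> carrier_mat n n" by (simp add: G_def)
  have "g x * G = 1\<^sub>m n"
  proof (intro eq_matI)
    fix i j assume "i < dim_row (1\<^sub>m n :: real mat)" "j < dim_col (1\<^sub>m n :: real mat)"
    then have ij: "i < n" "j < n" by auto
    have "(g x * G) $$ (i, j)
        = mmul n (mmul n (mtransp F') (mmul n eta F')) (mmul n H' (mmul n eta (mtransp H'))) i j"
      unfolding mat_mult_entry[OF g_carrier G ij]
      by (intro mmul_cong) (use ij in \<open>auto simp: g_entry G_def F'_def\<close>)
    also have "\<dots> = mmul n (mmul n (mtransp F') eta) (mmul n eta (mtransp H')) i j"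
      unfolding mmul_assoc[of n "mtransp F'" eta F', symmetric]
      by (rule mmul_cancel_mid) (rule FH')
    also have "\<dots> = mmul n (mtransp F') (mtransp H') i j"
      by (rule mmul_cancel_mid) (rule eta_sq)
    finally show "(g x * G) $$ (i, j) = 1\<^sub>m n $$ (i, j)"
      using ij by (simp add: HFt kron_def)
  qed (use g_carrier[of x] G in auto)
  moreover have "G * g x = 1\<^sub>m n"
  proof (intro eq_matI)
    fix i j assume "i < dim_row (1\<^sub>m n :: real mat)" "j < dim_col (1\<^sub>m n :: real mat)"
    then have ij: "i < n" "j < n" by auto
    have "(G * g x) $$ (i, j)
        = mmul n (mmul n H' (mmul n eta (mtransp H'))) (mmul n (mtransp F') (mmul n eta F')) i j"
      unfolding mat_mult_entry[OF G g_carrier ij]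
      by (intro mmul_cong) (use ij in \<open>auto simp: g_entry G_def F'_def\<close>)
    also have "\<dots> = mmul n (mmul n H' eta) (mmul n eta F') i j"
      unfolding mmul_assoc[of n H' eta "mtransp H'", symmetric]
      by (rule mmul_cancel_mid) (rule FHt)
    also have "\<dots> = mmul n H' F' i j"
      by (rule mmul_cancel_mid) (rule eta_sq)
    finally show "(G * g x) $$ (i, j) = 1\<^sub>m n $$ (i, j)"
      using ij by (simp add: HF' kron_def)
  qed (use g_carrier[of x] G in auto)
  ultimately have "inverse_metric g x = G"
    unfolding inverse_metric_def using mat_inverse_eqI[OF g_carrier G] by blast
  then show ?thesis using assms by (simp add: G_def H'_def)
qed

section \<open>Conjugation by the coframe and the Christoffel symbols\<close>

lemma sandwich_expand: "sandwich t X i j = (\<Sum>p<n. \<Sum>q<n. H t i p * X p q * F t q j)"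
  by (simp add: sandwich_def mmul_def sum_distrib_left mult_ac)

lemma sandwich_add: "sandwich t (\<lambda>i j. X i j + Y i j) i j = sandwich t X i j + sandwich t Y i j"
  by (simp add: sandwich_expand sum.distrib algebra_simps)

lemma sandwich_diff: "sandwich t (\<lambda>i j. X i j - Y i j) i j = sandwich t X i j - sandwich t Y i j"
  by (simp add: sandwich_expand sum_subtractf algebra_simps)

lemma sandwich_scale: "sandwich t (\<lambda>i j. c * X i j) i j = c * sandwich t X i j"
  by (simp add: sandwich_expand sum_distrib_left mult_ac)

lemma sandwich_sum: "sandwich t (\<lambda>i j. \<Sum>c<n. f c * X c i j) i j = (\<Sum>c<n. f c * sandwich t (X c) i j)"
proof -
  have "(\<Sum>p<n. \<Sum>q<n. H t i p * (\<Sum>c<n. f c * X c p q) * F t q j)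
      = (\<Sum>p<n. \<Sum>q<n. \<Sum>c<n. f c * (H t i p * X c p q * F t q j))"
    by (simp add: sum_distrib_left sum_distrib_right mult_ac)
  also have "\<dots> = (\<Sum>p<n. \<Sum>c<n. \<Sum>q<n. f c * (H t i p * X c p q * F t q j))"
    by (intro sum.cong refl sum.swap)
  also have "\<dots> = (\<Sum>c<n. \<Sum>p<n. \<Sum>q<n. f c * (H t i p * X c p q * F t q j))"
    by (rule sum.swap)
  finally show ?thesis by (simp add: sandwich_expand sum_distrib_left)
qed

lemma sandwich_mmul:
  "mmul n (sandwich t X) (sandwich t Y) i j = sandwich t (mmul n X Y) i j"
proof -
  have "mmul n (sandwich t X) (sandwich t Y) i j
      = mmul n (mmul n (mmul n (H t) X) (F t)) (mmul n (H t) (mmul n Y (F t))) i j"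
    by (simp add: sandwich_def mmul_assoc)
  also have "\<dots> = mmul n (mmul n (H t) X) (mmul n Y (F t)) i j"
    by (rule mmul_cancel_mid) (rule FH)
  finally show ?thesis by (simp add: sandwich_def mmul_assoc)
qed

text \<open>The Christoffel symbols at the origin, transported like a tensor. No inhomogeneous term
  occurs because the isometries \<open>(x', x_n) -> (e^(tA) x', x_n + t)\<close> are affine in these
  coordinates.\<close>

definition conn :: "real \<Rightarrow> nat \<Rightarrow> nat \<Rightarrow> nat \<Rightarrow> real" where
  "conn t l i j = (\<Sum>b<n. F t b l * sandwich t (D b) i j)"

lemma conn_closed_form:
  assumes "i < n" "j < n" "k < n"
  shows "conn t j i k = - (1/2) * (kron N j * sandwich t M i k + kron N k * sandwich t M i j
    - mmul n (H t) eta i N * K t j k)"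
proof -
  \<comment> \<open>Contracting \<open>F\<close> with \<open>kron N\<close> reads off the last row
    of \<open>F\<close>, which is that of the identity.\<close>
  have FN: "(\<Sum>b<n. F t b l * (kron N b * f b)) = kron N l * f N" if "l < n" for l f
  proof -
    have "(\<Sum>b<n. F t b l * (kron N b * f b)) = (\<Sum>b<n. kron N b * (F t b l * f b))"
      by (simp add: mult_ac)
    then show ?thesis using that N_less by (simp add: sum_kron_left F_last)
  qed
  have a: "(\<Sum>b<n. F t b j * sandwich t (\<lambda>a c. kron N b * M a c) i k) = kron N j * sandwich t M i k"
    using assms by (simp add: sandwich_scale FN)
  have "sandwich t (\<lambda>a c. kron N c * M a b) i k = kron N k * (\<Sum>p<n. H t i p * M p b)" for b
  proof -
    have "sandwich t (\<lambda>a c. kron N c * M a b) i k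
        = (\<Sum>p<n. H t i p * (\<Sum>q<n. F t q k * (kron N q * M p b)))"
      by (simp add: sandwich_expand sum_distrib_left mult_ac)
    then show ?thesis using assms by (simp add: FN sum_distrib_left mult_ac)
  qed
  then have "(\<Sum>b<n. F t b j * sandwich t (\<lambda>a c. kron N c * M a b) i k)
      = kron N k * mmul n (mmul n (H t) M) (F t) i j"
    by (simp add: mmul_def sum_distrib_left mult_ac)
  then have b: "(\<Sum>b<n. F t b j * sandwich t (\<lambda>a c. kron N c * M a b) i k)
      = kron N k * sandwich t M i j"
    by (simp add: sandwich_def mmul_assoc)
  have "sandwich t (\<lambda>a c. eta a N * B b c) i k = mmul n (H t) eta i N * mmul n B (F t) b k" for b
    by (simp add: sandwich_expand mmul_def sum_product mult_ac)
  then have c: "(\<Sum>b<n. F t b j * sandwich t (\<lambda>a c. eta a N * B b c) i k)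
      = mmul n (H t) eta i N * K t j k"
    by (simp add: K_def mmul_def[of n "mtransp (F t)"] mtransp_def sum_distrib_left mult_ac)
  have "sandwich t (D b) i k = - (1/2) * (sandwich t (\<lambda>a c. kron N b * M a c) i k
      + sandwich t (\<lambda>a c. kron N c * M a b) i k - sandwich t (\<lambda>a c. eta a N * B b c) i k)" for b
    unfolding D_def[abs_def] by (simp only: sandwich_add sandwich_diff sandwich_scale)
  note sw = this
  have "conn t j i k = - (1/2) * ((\<Sum>b<n. F t b j * sandwich t (\<lambda>a c. kron N b * M a c) i k)
      + (\<Sum>b<n. F t b j * sandwich t (\<lambda>a c. kron N c * M a b) i k)
      - (\<Sum>b<n. F t b j * sandwich t (\<lambda>a c. eta a N * B b c) i k))"
    unfolding conn_def sw
    by (simp add: sum.distrib sum_subtractf sum_distrib_left algebra_simps sum_negf)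
  then show ?thesis unfolding a b c .
qed

lemma christoffel_eq:
  assumes x: "x \<in> carrier_vec n" and ijk: "i < n" "j < n" "k < n"
  shows "christoffel n g i j k x = conn (x $ N) j i k"
proof -
  define t where "t = x $ N"
  define G where "G = mmul n (H t) (mmul n eta (mtransp (H t)))"
  \<comment> \<open>In \<open>(H eta H^T) (F^T B F)\<close> the transposed factors cancel, leaving
    \<open>H eta B F\<close>, the conjugate of \<open>M\<close>.\<close>
  have GK: "(\<Sum>l<n. G i l * K t l j) = sandwich t M i j" for j
  proof -
    have "mmul n G (K t) i j
        = mmul n (mmul n (mmul n (H t) eta) (mtransp (H t))) (mmul n (mtransp (F t)) (mmul n B (F t))) i j"
      by (simp add: G_def K_def mmul_assoc)
    also have "\<dots> = mmul n (mmul n (H t) eta) (mmul n B (F t)) i j"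
      by (rule mmul_cancel_mid)
        (use FH[of _ _ t] in \<open>simp add: mtransp_mmul[symmetric] mtransp_def kron_sym\<close>)
    finally show ?thesis
      by (simp add: mmul_def[of n G] sandwich_def M_def mmul_assoc)
  qed
  \<comment> \<open>The right factor \<open>H^T\<close> disappears in column \<open>N\<close>
    because the last row of \<open>H\<close> is that of the identity.\<close>
  have GN: "G i N = mmul n (H t) eta i N"
  proof -
    have "G i N = mmul n (mmul n (H t) eta) (mtransp (H t)) i N"
      by (simp add: G_def mmul_assoc)
    also have "\<dots> = mmul n (mmul n (H t) eta) kron i N"
      by (intro mmul_cong refl) (simp add: mtransp_def H_last kron_sym)
    finally show ?thesis by (simp add: mmul_kron_right N_less)
  qed
  have Ksym: "K t l k = K t k l" for k l
  proof -
    have "mtransp B = B"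
      by (intro ext) (simp add: B_def[abs_def] mtransp_def mmul_def eta_sym[of _ "_ :: nat"] mult.commute add.commute)
    then have "mtransp (K t) = K t"
      by (simp add: K_def mtransp_mmul mmul_assoc) (simp add: mtransp_def[abs_def])
    then show ?thesis by (metis mtransp_def)
  qed
  have "christoffel n g i j k x = (1/2) * (\<Sum>l<n. G i l *
      (- kron N j * K t l k - kron N k * K t l j + kron N l * K t j k))"
    unfolding christoffel_def
    by (intro arg_cong2[where f = "(*)"] sum.cong refl)
      (use x ijk in \<open>auto simp: inverse_metric_entry partial_deriv_metric G_def t_def\<close>)
  also have "\<dots> = - (1/2) * (kron N j * (\<Sum>l<n. G i l * K t l k) + kron N k * (\<Sum>l<n. G i l * K t l j)
      - (\<Sum>l<n. kron N l * (G i l * K t j k)))"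
    by (simp add: sum_distrib_left sum.distrib sum_subtractf algebra_simps sum_negf)
  also have "\<dots> = conn t j i k"
    unfolding GK using ijk by (simp add: sum_kron_left N_less GN conn_closed_form)
  finally show ?thesis by (simp add: t_def)
qed

text \<open>The derivative of \<open>H X F\<close> is the conjugate of the commutator
  \<open>[Ah, X]\<close>, and differentiating the coefficient \<open>F\<close> contributes
  \<open>- Ah F\<close>. Together these are the three terms of \<open>rho\<close>.\<close>

lemma conn_deriv:
  assumes "i < n" "j < n" "l < n"
  shows "((\<lambda>t. conn t l i j) has_real_derivative (\<Sum>b<n. F t b l * sandwich t (rho b) i j)) (at t)"
proof -
  have DF: "((\<lambda>t. mmul n X (F t) c j) has_real_derivative - mmul n X (mmul n Ah (F t)) c j) (at t)"
    for c X
    using mmul_deriv[of n "\<lambda>t. X" c "\<lambda>i j. 0" t F j "\<lambda>i j. - mmul n Ah (F t) i j"]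
      F_deriv assms by (simp add: mmul_zero_left mmul_minus_right)
  have sw: "((\<lambda>t. sandwich t X i j) has_real_derivative
      sandwich t (\<lambda>i j. mmul n Ah X i j - mmul n X Ah i j) i j) (at t)" for X
  proof -
    have "((\<lambda>t. mmul n (H t) (mmul n X (F t)) i j) has_real_derivative
      mmul n (mmul n (H t) Ah) (mmul n X (F t)) i j
      + mmul n (H t) (\<lambda>i j. - mmul n X (mmul n Ah (F t)) i j) i j) (at t)"
      by (rule mmul_deriv) (use H_deriv assms DF in auto)
    then show ?thesis
      unfolding sandwich_diff by (simp add: sandwich_def mmul_minus_right mmul_assoc)
  qed
  have "((\<lambda>t. conn t l i j) has_real_derivative
      (\<Sum>b<n. - mmul n Ah (F t) b l * sandwich t (D b) i j
        + sandwich t (\<lambda>i j. mmul n Ah (D b) i j - mmul n (D b) Ah i j) i j * F t b l)) (at t)"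
    unfolding conn_def by (intro DERIV_sum DERIV_mult sw F_deriv) (use assms in auto)
  moreover have "(\<Sum>b<n. - mmul n Ah (F t) b l * sandwich t (D b) i j
        + sandwich t (\<lambda>i j. mmul n Ah (D b) i j - mmul n (D b) Ah i j) i j * F t b l)
      = (\<Sum>b<n. F t b l * sandwich t (rho b) i j)"
    unfolding rho_def[abs_def] sandwich_diff[of t "\<lambda>i j. mmul n Ah (D _) i j - mmul n (D _) Ah i j"]
    by (simp add: sandwich_sum sum.distrib sum_negf sum_mmul_swap sum_subtractf algebra_simps)
  ultimately show ?thesis by simp
qed

section \<open>Curvature as the transport of its value at the origin\<close>

lemma partial_deriv_christoffel:
  assumes "x \<in> carrier_vec n" "i < n" "j < n" "k < n" "l < n"
  shows "partial_deriv n k (christoffel n g i l j) x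
    = kron N k * (\<Sum>b<n. F (x $ N) b l * sandwich (x $ N) (rho b) i j)"
  by (rule partial_deriv_last_coord[where \<phi> = "\<lambda>t. conn t l i j"])
    (use assms n_pos in \<open>auto intro: christoffel_eq conn_deriv\<close>)

text \<open>Conjugation is multiplicative, so the quadratic terms transport like the connection
  itself. In the derivative terms \<open>kron N k\<close> is written as a contraction of
  \<open>F\<close> with \<open>kron N\<close>, which brings all terms under one double sum.\<close>

lemma riemann_eq:
  assumes x: "x \<in> carrier_vec n" and ijkl: "i < n" "j < n" "k < n" "l < n"
  shows "riemann n g i j k l x = (\<Sum>a<n. \<Sum>b<n. F (x $ N) a k * F (x $ N) b l * sandwich (x $ N) (R0 a b) i j)"
proof -
  define t where "t = x $ N"
  define r where "r b = sandwich t (rho b) i j" for b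
  define c where "c a b = sandwich t (mmul n (D a) (D b)) i j" for a b
  have FN: "(\<Sum>a<n. F t a k * (kron N a * s)) = kron N k * s" if "k < n" for k s
  proof -
    have "(\<Sum>a<n. F t a k * (kron N a * s)) = (\<Sum>a<n. kron N a * (F t a k * s))"
      by (simp add: mult_ac)
    then show ?thesis using that N_less by (simp add: sum_kron_left F_last)
  qed
  have conn2: "(\<Sum>m<n. conn t k i m * conn t l m j) = (\<Sum>a<n. \<Sum>b<n. F t a k * F t b l * c a b)" for k l
  proof -
    have "(\<Sum>m<n. conn t k i m * conn t l m j)
       = (\<Sum>m<n. \<Sum>a<n. \<Sum>b<n. F t a k * F t b l * (sandwich t (D a) i m * sandwich t (D b) m j))"
      by (simp add: conn_def sum_product mult_ac)
    also have "\<dots> = (\<Sum>a<n. \<Sum>m<n. \<Sum>b<n. F t a k * F t b l * (sandwich t (D a) i m * sandwich t (D b) m j))"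
      by (rule sum.swap)
    also have "\<dots> = (\<Sum>a<n. \<Sum>b<n. \<Sum>m<n. F t a k * F t b l * (sandwich t (D a) i m * sandwich t (D b) m j))"
      by (intro sum.cong refl sum.swap)
    also have "\<dots> = (\<Sum>a<n. \<Sum>b<n. F t a k * F t b l * c a b)"
      unfolding c_def sandwich_mmul[symmetric] by (simp add: mmul_def sum_distrib_left)
    finally show ?thesis .
  qed
  have swap: "(\<Sum>a<n. \<Sum>b<n. F t a l * F t b k * c a b) = (\<Sum>a<n. \<Sum>b<n. F t a k * F t b l * c b a)"
    by (subst sum.swap) (simp add: mult_ac)
  have R: "sandwich t (R0 a b) i j = kron N a * r b - kron N b * r a + (c a b - c b a)" for a b
    unfolding R0_def[abs_def]
    by (simp add: sandwich_add sandwich_diff sandwich_scale r_def c_def)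
  have "riemann n g i j k l x = kron N k * (\<Sum>b<n. F t b l * r b) - kron N l * (\<Sum>b<n. F t b k * r b)
      + ((\<Sum>m<n. conn t k i m * conn t l m j) - (\<Sum>m<n. conn t l i m * conn t k m j))"
    unfolding riemann_def using x ijkl
    by (simp add: partial_deriv_christoffel christoffel_eq t_def r_def sum_subtractf)
  also have "\<dots> = (\<Sum>b<n. F t b l * (\<Sum>a<n. F t a k * (kron N a * r b)))
      - (\<Sum>a<n. F t a k * (\<Sum>b<n. F t b l * (kron N b * r a)))
      + ((\<Sum>a<n. \<Sum>b<n. F t a k * F t b l * c a b) - (\<Sum>a<n. \<Sum>b<n. F t a k * F t b l * c b a))"
    unfolding conn2 swap using ijkl by (simp add: FN) (simp add: sum_distrib_left mult_ac)
  also have "(\<Sum>b<n. F t b l * (\<Sum>a<n. F t a k * (kron N a * r b)))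
      = (\<Sum>a<n. \<Sum>b<n. F t a k * F t b l * (kron N a * r b))"
    unfolding sum_distrib_left by (subst sum.swap) (simp add: mult_ac)
  also have "(\<Sum>a<n. F t a k * (\<Sum>b<n. F t b l * (kron N b * r a)))
      = (\<Sum>a<n. \<Sum>b<n. F t a k * F t b l * (kron N b * r a))"
    by (simp add: sum_distrib_left mult_ac)
  finally show ?thesis
    unfolding R t_def[symmetric]
    by (simp add: right_diff_distrib distrib_left sum.distrib sum_subtractf)
qed

lemma riemann_origin:
  assumes "i < n" "j < n" "k < n" "l < n"
  shows "riemann n g i j k l (0\<^sub>v n) = R0 k l i j"
proof -
  have "sandwich 0 X i j = X i j" for X
  proof -
    have "sandwich 0 X i j = mmul n kron (mmul n X kron) i j"
      unfolding sandwich_def using assms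
      by (intro mmul_cong) (auto simp: H_0 F_0)
    then show ?thesis using assms by (simp add: mmul_kron_left mmul_kron_right)
  qed
  then have "riemann n g i j k l (0\<^sub>v n) = (\<Sum>a<n. \<Sum>b<n. kron a k * kron b l * R0 a b i j)"
    using riemann_eq[of "0\<^sub>v n" i j k l] assms n_pos by (simp add: F_0)
  also have "\<dots> = (\<Sum>a<n. kron a k * (\<Sum>b<n. R0 a b i j * kron b l))"
    by (simp add: sum_distrib_left mult_ac)
  also have "\<dots> = (\<Sum>a<n. R0 a l i j * kron a k)"
    using assms by (simp add: sum_kron_right mult.commute[of "kron _ _"])
  also have "\<dots> = R0 k l i j" using assms by (simp add: sum_kron_right)
  finally show ?thesis .
qed

text \<open>The origin gives one direction. For the other, the curvature at every point depends
  linearly on the constants \<open>R0\<close>.\<close>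

lemma flat_iff:
  "flat n g \<longleftrightarrow> (\<forall>a<n. \<forall>b<n. \<forall>i<n. \<forall>j<n. R0 a b i j = 0)"
proof
  assume "flat n g"
  then show "\<forall>a<n. \<forall>b<n. \<forall>i<n. \<forall>j<n. R0 a b i j = 0"
    by (auto simp: flat_def riemann_origin[symmetric])
next
  assume "\<forall>a<n. \<forall>b<n. \<forall>i<n. \<forall>j<n. R0 a b i j = 0"
  then have "sandwich t (R0 a b) i j = 0" if "a < n" "b < n" for a b i j t
    using that by (simp add: sandwich_expand)
  then show "flat n g"
    by (simp add: flat_def riemann_eq)
qed

lemma flat_imp_ricci_flat: "flat n g \<Longrightarrow> ricci_flat n g"
  by (simp add: flat_def ricci_flat_def ricci_def)

lemma ricci_flat_origin:
  assumes "ricci_flat n g" "j < n" "l < n"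
  shows "(\<Sum>i<n. R0 i l i j) = 0"
proof -
  have "ricci n g j l (0\<^sub>v n) = 0"
    using assms by (auto simp: ricci_flat_def)
  then show ?thesis using assms by (simp add: ricci_def riemann_origin)
qed

end

section \<open>The coframe of an almost abelian group\<close>

lemma exp_mat_carrier: "A \<in> carrier_mat m m \<Longrightarrow> exp_mat A \<in> carrier_mat m m"
  by (auto simp: exp_mat_def)

lemma sum_mult_kron_less: "j \<ge> m \<Longrightarrow> (\<Sum>c<m. f c * kron c j) = 0"
  by (auto simp: kron_def intro!: sum.neutral)

text \<open>The exponent is \<open>- t A\<close>, so the inverse coframe is the same family at
  \<open>- t\<close>. Indices outside the block fall back to \<open>kron\<close>, which supplies the
  bordering \<open>1\<close>.\<close>

definition coframe :: "nat \<Rightarrow> real mat \<Rightarrow> real \<Rightarrow> nat \<Rightarrow> nat \<Rightarrow> real" where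
  "coframe m A t i j = (if i < m \<and> j < m then exp_mat ((- t) \<cdot>\<^sub>m A) $$ (i, j) else kron i j)"

lemma coframe_mult_inverse:
  assumes A: "A \<in> carrier_mat m m" and ij: "i < Suc m" "j < Suc m"
  shows "mmul (Suc m) (coframe m A (- t)) (coframe m A t) i j = kron i j"
proof (cases "i < m \<and> j < m")
  case True
  then show ?thesis
    using exp_mat_inverse[OF A, of i j t] by (simp add: mmul_def coframe_def kron_def)
next
  case False
  with ij have "i = m \<or> j = m" by auto
  then show ?thesis
    using ij by (auto simp: mmul_def coframe_def kron_def intro!: sum.neutral)
qed

lemma exp_coframe_almost_abelian:
  assumes A: "A \<in> carrier_mat m m" and eta: "eta \<in> carrier_mat (Suc m) (Suc m)"
    and e: "\<And>i j. i < Suc m \<Longrightarrow> j < Suc m \<Longrightarrow> eta $$ (i, j) = e i j"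
    and sym: "\<And>i j. e i j = e j i"
    and sq: "\<And>i j. i < Suc m \<Longrightarrow> j < Suc m \<Longrightarrow> mmul (Suc m) e e i j = kron i j"
    and Ah: "\<And>i j. Ah i j = (if i < m \<and> j < m then A $$ (i, j) else 0)"
  shows "exp_coframe (Suc m) e Ah (coframe m A) (\<lambda>t. coframe m A (- t))
    (almost_abelian_metric (Suc m) A eta)"
proof
  show "0 < Suc m" by simp
next
  fix i j t assume ij: "i < Suc m" "j < Suc m"
  show "((\<lambda>t. coframe m A t i j) has_real_derivative - mmul (Suc m) Ah (coframe m A t) i j) (at t)"
  proof (cases "i < m \<and> j < m")
    case True
    then show ?thesis
      using DERIV_chain2[OF exp_mat_deriv_left[OF A, of i j "- t"] DERIV_minus[OF DERIV_ident]]
      by (simp add: mmul_def coframe_def Ah)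
  next
    case False
    then show ?thesis
      using ij by (cases "i < m") (auto simp: mmul_def coframe_def Ah sum_mult_kron_less)
  qed
  show "((\<lambda>t. coframe m A (- t) i j) has_real_derivative mmul (Suc m) (coframe m A (- t)) Ah i j) (at t)"
  proof (cases "i < m \<and> j < m")
    case True
    then show ?thesis
      using exp_mat_deriv[OF A, of i j t]
      by (simp add: mmul_def coframe_def Ah)
  next
    case False
    then show ?thesis
      using ij by (cases "j < m") (auto simp: mmul_def coframe_def Ah kron_def)
  qed
  show "mmul (Suc m) (coframe m A (- t)) (coframe m A t) i j = kron i j"
    by (rule coframe_mult_inverse[OF A ij])
  show "mmul (Suc m) (coframe m A t) (coframe m A (- t)) i j = kron i j"
    using coframe_mult_inverse[OF A ij, of "- t"] by simp
  show "coframe m A 0 i j = kron i j"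
    by (simp add: coframe_def kron_def exp_mat_0[OF A])
next
  fix j t assume "j < Suc m"
  then show "coframe m A t (Suc m - 1) j = kron (Suc m - 1) j"
    by (simp add: coframe_def)
next
  fix x :: "real vec"
  define t where "t = x $ m"
  define Pm where "Pm = four_block_mat (exp_mat ((- t) \<cdot>\<^sub>m transpose_mat A)) (0\<^sub>m m 1) (0\<^sub>m 1 m) (1\<^sub>m 1)"
  define Qm where "Qm = four_block_mat (exp_mat ((- t) \<cdot>\<^sub>m A)) (0\<^sub>m m 1) (0\<^sub>m 1 m) (1\<^sub>m 1)"
  have c1: "exp_mat ((- t) \<cdot>\<^sub>m transpose_mat A) \<in> carrier_mat m m"
    and c2: "exp_mat ((- t) \<cdot>\<^sub>m A) \<in> carrier_mat m m"
    using A by (auto intro: exp_mat_carrier)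
  have P: "Pm \<in> carrier_mat (Suc m) (Suc m)" and Q: "Qm \<in> carrier_mat (Suc m) (Suc m)"
    using c1 c2 by (auto simp: Pm_def Qm_def intro!: carrier_matI)
  have g: "almost_abelian_metric (Suc m) A eta x = Pm * eta * Qm"
    by (simp add: almost_abelian_metric_def Pm_def Qm_def t_def)
  show "almost_abelian_metric (Suc m) A eta x \<in> carrier_mat (Suc m) (Suc m)"
    unfolding g using P Q eta by auto
  fix i j assume ij: "i < Suc m" "j < Suc m"
  have Pe: "Pm $$ (i, j) = mtransp (coframe m A t) i j" if "i < Suc m" "j < Suc m" for i j
    using that c1 exp_mat_transpose[OF A, of i j "- t"]
    by (auto simp: Pm_def mtransp_def coframe_def kron_def less_Suc_eq)
  have Qe: "Qm $$ (i, j) = coframe m A t i j" if "i < Suc m" "j < Suc m" for i j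
    using that c2 by (auto simp: Qm_def coframe_def kron_def less_Suc_eq)
  have "(Pm * eta * Qm) $$ (i, j) = mmul (Suc m) (\<lambda>i j. (Pm * eta) $$ (i, j)) (\<lambda>i j. Qm $$ (i, j)) i j"
    using P Q eta ij by (intro mat_mult_entry) auto
  also have "\<dots> = mmul (Suc m) (mmul (Suc m) (mtransp (coframe m A t)) e) (coframe m A t) i j"
  proof (intro mmul_cong)
    fix c assume c: "c < Suc m"
    show "(Pm * eta) $$ (i, c) = mmul (Suc m) (mtransp (coframe m A t)) e i c"
      unfolding mat_mult_entry[OF P eta ij(1) c]
      by (intro mmul_cong) (use ij c Pe e in auto)
    show "Qm $$ (c, j) = coframe m A t c j" using Qe c ij by simp
  qed
  finally show "almost_abelian_metric (Suc m) A eta x $$ (i, j)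
      = mmul (Suc m) (mtransp (coframe m A (x $ (Suc m - 1))))
          (mmul (Suc m) e (coframe m A (x $ (Suc m - 1)))) i j"
    unfolding g by (simp add: t_def mmul_assoc)
qed (use sym sq in auto)

section \<open>Rank at most one and minors of size two\<close>

lemma det_2x2:
  fixes X :: "'a :: comm_ring_1 mat"
  assumes X: "X \<in> carrier_mat 2 2"
  shows "det X = X $$ (0, 0) * X $$ (1, 1) - X $$ (0, 1) * X $$ (1, 0)"
proof -
  have d: "mat_delete X 0 j \<in> carrier_mat 1 1" for j
    using X by (auto simp: mat_delete_def)
  have "det X = (\<Sum>j<2. X $$ (0, j) * cofactor X 0 j)"
    using laplace_expansion_row[OF X, of 0] by simp
  also have "\<dots> = X $$ (0, 0) * cofactor X 0 0 + X $$ (0, 1) * cofactor X 0 1"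
    by (simp add: numeral_2_eq_2 One_nat_def)
  finally show ?thesis
    using X by (simp add: cofactor_def det_single[OF d]) (simp add: mat_delete_def One_nat_def)
qed

text \<open>If all minors vanish, a nonzero entry serves as pivot and the matrix is a column times a
  row. Conversely a nonzero minor would force rank at least two. Repeated or reordered indices
  reduce to increasing ones.\<close>

lemma (in vec_space) rank_le_1_iff:
  assumes A: "A \<in> carrier_mat n nc"
  shows "rank A \<le> 1 \<longleftrightarrow> (\<forall>i<n. \<forall>k<n. \<forall>j<nc. \<forall>l<nc. A $$ (i, j) * A $$ (k, l) = A $$ (i, l) * A $$ (k, j))"
    (is "_ \<longleftrightarrow> ?minors")
proof
  assume ?minors
  show "rank A \<le> 1"
  proof (cases "\<exists>a<n. \<exists>b<nc. A $$ (a, b) \<noteq> 0")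
    case True
    then obtain a b where ab: "a < n" "b < nc" "A $$ (a, b) \<noteq> 0" by blast
    show ?thesis
    proof (rule rank_le_1_product_entries[OF A, of "\<lambda>i. A $$ (i, b)" "\<lambda>j. A $$ (a, j) / A $$ (a, b)"])
      fix r c assume "r < dim_row A" "c < dim_col A"
      then have "A $$ (r, c) * A $$ (a, b) = A $$ (r, b) * A $$ (a, c)"
        using \<open>?minors\<close> ab A by auto
      then show "A $$ (r, c) = A $$ (r, b) * (A $$ (a, c) / A $$ (a, b))"
        using ab by (simp add: field_simps)
    qed
  next
    case False
    then show ?thesis
      using A by (intro rank_le_1_product_entries[OF A, of "\<lambda>i. 0" "\<lambda>j. 0"]) auto
  qed
next
  assume rank: "rank A \<le> 1"
  \<comment> \<open>\<open>pick\<close> enumerates an index set increasingly, hence the restriction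
    to ordered pairs.\<close>
  have pick2: "pick {i, k} 0 = i" "pick {i, k} (Suc 0) = k" if "i < k" for i k :: nat
  proof -
    show p0: "pick {i, k} 0 = i"
      using that by (auto intro!: Least_equality)
    show "pick {i, k} (Suc 0) = k"
      unfolding pick.simps using that by (auto simp: p0[simplified] intro!: Least_equality)
  qed
  have minor: "A $$ (i, j) * A $$ (k, l) = A $$ (i, l) * A $$ (k, j)"
    if "i < k" "k < n" "j < l" "l < nc" for i j k l
  proof (rule ccontr)
    assume ne: "A $$ (i, j) * A $$ (k, l) \<noteq> A $$ (i, l) * A $$ (k, j)"
    let ?X = "submatrix A {i, k} {j, l}"
    have rows: "{a. a < dim_row A \<and> a \<in> {i, k}} = {i, k}"
      and cols: "{a. a < dim_col A \<and> a \<in> {j, l}} = {j, l}"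
      using that A by auto
    have dim: "?X \<in> carrier_mat 2 2"
      using that unfolding submatrix_def rows cols by auto
    have X: "?X $$ (a, b) = A $$ (pick {i, k} a, pick {j, l} b)" if "a < 2" "b < 2" for a b
      using that \<open>i < k\<close> \<open>j < l\<close> by (intro submatrix_index; unfold rows cols) simp_all
    have "det ?X = A $$ (i, j) * A $$ (k, l) - A $$ (i, l) * A $$ (k, j)"
      using that by (simp add: det_2x2[OF dim] X pick2 pick2[unfolded One_nat_def[symmetric]] del: pick.simps)
    then have "det ?X \<noteq> 0" using ne by simp
    then have "card {a. a < nc \<and> a \<in> {j, l}} \<le> rank A"
      by (rule rank_gt_minor[OF A])
    then show False using rank cols A that by auto
  qed
  show ?minors
  proof (intro allI impI)
    fix i k j l assume r: "i < n" "k < n" "j < nc" "l < nc"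
    consider "i = k \<or> j = l" | "i < k" "j < l" | "i < k" "l < j" | "k < i" "j < l" | "k < i" "l < j"
      by linarith
    then show "A $$ (i, j) * A $$ (k, l) = A $$ (i, l) * A $$ (k, j)"
    proof cases
      case 1
      then show ?thesis by (elim disjE) (simp_all only: mult.commute)
    next
      case 2
      then show ?thesis using minor r by blast
    next
      case 3
      then show ?thesis using minor[of i k l j] r by simp
    next
      case 4
      then show ?thesis using minor[of k i j l] r by (metis mult.commute)
    next
      case 5
      then show ?thesis using minor[of k i l j] r by (metis mult.commute)
    qed
  qed
qed

section \<open>Block diagonal \<open>eta\<close>\<close>

text \<open>\<open>P\<close> holds the signs of the first \<open>m\<close> coordinates and
  \<open>eps\<close> that of the last, which covers cases (a) and (b). \<open>S\<close> is
  self-adjoint and \<open>T\<close> skew-adjoint for the form with diagonal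
  \<open>P\<close>.\<close>

locale exp_coframe_diag = exp_coframe "Suc m" eta Ah F H g for m eta Ah F H g +
  fixes S T :: "nat \<Rightarrow> nat \<Rightarrow> real" and P :: "nat \<Rightarrow> real" and eps :: real
  assumes eta_diag: "\<And>i j. i < Suc m \<Longrightarrow> j < Suc m \<Longrightarrow>
      eta i j = kron i j * (if i < m then P i else eps)"
    and P_sq: "\<And>i. i < m \<Longrightarrow> P i * P i = 1"
    and eps_sq: "eps * eps = 1"
    and Ah_block: "\<And>i j. i < m \<Longrightarrow> j < m \<Longrightarrow> Ah i j = S i j + T i j"
    and Ah_row [simp]: "\<And>j. Ah m j = 0"
    and Ah_col [simp]: "\<And>i. Ah i m = 0"
    and S_sym: "\<And>i j. i < m \<Longrightarrow> j < m \<Longrightarrow> P i * S i j = P j * S j i"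
    and T_skew: "\<And>i j. i < m \<Longrightarrow> j < m \<Longrightarrow> P i * T i j = - (P j * T j i)"
begin

lemma kron_last [simp]: "kron m m = 1" "i < m \<Longrightarrow> kron i m = 0" "i < m \<Longrightarrow> kron m i = 0"
  by (auto simp: kron_def)

lemma mmul_eta_right:
  assumes "j < Suc m"
  shows "mmul (Suc m) X eta i j = X i j * (if j < m then P j else eps)"
proof -
  have "mmul (Suc m) X eta i j = (\<Sum>c<Suc m. (X i c * (if c < m then P c else eps)) * kron c j)"
    unfolding mmul_def by (intro sum.cong refl) (use assms in \<open>simp add: eta_diag\<close>)
  also have "\<dots> = X i j * (if j < m then P j else eps)"
    using assms by (rule sum_kron_right)
  finally show ?thesis .
qed

lemma mmul_eta_left:
  assumes "i < Suc m"
  shows "mmul (Suc m) eta X i j = (if i < m then P i else eps) * X i j"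
proof -
  have "mmul (Suc m) eta X i j = (\<Sum>c<Suc m. kron i c * ((if i < m then P i else eps) * X c j))"
    unfolding mmul_def by (intro sum.cong refl) (use assms in \<open>simp add: eta_diag\<close>)
  also have "\<dots> = (if i < m then P i else eps) * X i j"
    using assms by (rule sum_kron_left)
  finally show ?thesis .
qed

text \<open>The skew-adjoint part cancels, so the connection at the origin depends on
  \<open>S\<close> alone; \<open>T\<close> enters the curvature through \<open>rho\<close>.\<close>

lemma B_values:
  "u < m \<Longrightarrow> w < m \<Longrightarrow> B u w = 2 * (P u * S u w)"
  "j < Suc m \<Longrightarrow> B m j = 0" "i < Suc m \<Longrightarrow> B i m = 0"
proof -
  assume uw: "u < m" "w < m"
  show "B u w = 2 * (P u * S u w)"
    using uw S_sym[OF uw] T_skew[OF uw]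
    by (simp add: B_def mmul_eta_left mmul_eta_right mtransp_def Ah_block algebra_simps)
qed (simp_all add: B_def mmul_eta_left mmul_eta_right mtransp_def)

lemma M_values:
  "u < m \<Longrightarrow> w < m \<Longrightarrow> M u w = 2 * S u w"
  "j < Suc m \<Longrightarrow> M m j = 0" "i < Suc m \<Longrightarrow> M i m = 0"
proof -
  assume uw: "u < m" "w < m"
  have "M u w = 2 * (P u * P u) * S u w"
    using uw by (simp add: M_def mmul_eta_left B_values)
  then show "M u w = 2 * S u w" using uw by (simp add: P_sq)
qed (simp_all add: M_def mmul_eta_left B_values)

lemma D_values [simp]:
  "u < m \<Longrightarrow> w < m \<Longrightarrow> D m u w = - S u w"
  "w < m \<Longrightarrow> D m m w = 0"
  "u < m \<Longrightarrow> D m u m = 0"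
  "D m m m = 0"
  "u < m \<Longrightarrow> v < m \<Longrightarrow> w < m \<Longrightarrow> D u v w = 0"
  "u < m \<Longrightarrow> w < m \<Longrightarrow> D u m w = eps * (P u * S u w)"
  "u < m \<Longrightarrow> v < m \<Longrightarrow> D u v m = - S v u"
  "u < m \<Longrightarrow> D u m m = 0"
  by (simp_all add: D_def M_values B_values eta_diag)

text \<open>The operator \<open>\<partial>_v \<mapsto> R(\<partial>_m, \<partial>_v)
  \<partial>_m\<close> at the origin, namely \<open>S^2 - [T, S]\<close>.\<close>

definition Q :: "nat \<Rightarrow> nat \<Rightarrow> real" where
  "Q u v = mmul m S S u v - (mmul m T S u v - mmul m S T u v)"

lemma R0_last_block:
  assumes "v < m" "w < m"
  shows "R0 m v m w = - eps * (P v * Q v w)"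
proof -
  have PS: "P c * S c w' = P w' * S w' c" if "c < m" "w' < m" for c w' using S_sym that .
  have "R0 m v m w = - (\<Sum>c<m. eps * (P v * S v c) * (S c w + T c w))
     - (\<Sum>c<m. (S c v + T c v) * (eps * (P c * S c w))) + (\<Sum>c<m. eps * (P v * S v c) * S c w)"
    using assms by (simp add: R0_def rho_def mmul_def Ah_block sum_negf cong: sum.cong_simp)
  \<comment> \<open>Moving \<open>P\<close> across transposes both matrices and flips the sign of
    \<open>T\<close>.\<close>
  also have "(\<Sum>c<m. (S c v + T c v) * (eps * (P c * S c w)))
      = (\<Sum>c<m. eps * P v * (S v c - T v c) * S c w)"
  proof (intro sum.cong refl)
    fix c assume "c \<in> {..<m}"
    then have "(P c * S c v + P c * T c v) = P v * (S v c - T v c)"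
      using S_sym[of c v] T_skew[of c v] assms by (simp add: algebra_simps)
    then show "(S c v + T c v) * (eps * (P c * S c w)) = eps * P v * (S v c - T v c) * S c w"
      by (metis (no_types, opaque_lifting) distrib_left mult.assoc mult.left_commute mult.commute)
  qed
  finally have R: "R0 m v m w = - ((\<Sum>c<m. eps * (P v * S v c) * (S c w + T c w))
     + (\<Sum>c<m. eps * P v * (S v c - T v c) * S c w) - (\<Sum>c<m. eps * (P v * S v c) * S c w))"
    by simp
  have "Q v w = (\<Sum>c<m. S v c * S c w - (T v c * S c w - S v c * T c w))"
    by (simp add: Q_def mmul_def sum_subtractf)
  then show ?thesis
    unfolding R sum.distrib[symmetric] sum_subtractf[symmetric]
    by (simp add: sum_distrib_left sum_negf[symmetric] algebra_simps)
qed

lemma R0_block_last: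
  assumes "u < m" "v < m"
  shows "R0 m v u m = Q u v"
proof -
  have "R0 m v u m = - (\<Sum>c<m. (S u c + T u c) * S c v) + (\<Sum>c<m. (S c v + T c v) * S u c)
      + (\<Sum>c<m. S u c * S c v)"
    using assms by (simp add: R0_def rho_def mmul_def Ah_block sum_negf cong: sum.cong_simp)
  then show ?thesis
    by (simp add: Q_def mmul_def sum.distrib algebra_simps)
qed

lemma R0_last_zero [simp]:
  "u < m \<Longrightarrow> v < m \<Longrightarrow> w < m \<Longrightarrow> R0 m v u w = 0"
  "v < m \<Longrightarrow> R0 m v m m = 0"
  by (simp_all add: R0_def rho_def mmul_def cong: sum.cong_simp)

text \<open>This is the Gauss equation: the hypersurfaces of constant last coordinate are
  intrinsically flat, with shape operator \<open>S\<close> up to sign, so their curvature terms are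
  minors of \<open>S\<close>.\<close>

lemma R0_block_block:
  assumes "u < m" "v < m" "w < m" "x < m"
  shows "R0 u v x w = eps * (P u * S u w * S x v - P v * S v w * S x u)"
  using assms by (simp add: R0_def mmul_def algebra_simps cong: sum.cong_simp)

lemma R0_block_zero [simp]:
  assumes "u < m" "v < m"
  shows "x < m \<Longrightarrow> R0 u v x m = 0" "w < m \<Longrightarrow> R0 u v m w = 0" "R0 u v m m = 0"
proof -
  \<comment> \<open>Since \<open>P S\<close> is symmetric, moving \<open>P\<close> twice exchanges
    \<open>u\<close> and \<open>v\<close> in every summand, so the two products in the commutator of
    \<open>D u\<close> and \<open>D v\<close> agree here.\<close>
  have "eps * (\<Sum>c<m. P u * S u c * S c v) = eps * (\<Sum>c<m. P v * S v c * S c u)"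
  proof -
    have "P u * S u c * S c v = P v * S v c * S c u" if "c < m" for c
    proof -
      have "P u * S u c * S c v = P c * S c u * S c v" using S_sym[of u c] that assms by simp
      also have "\<dots> = (P c * S c v) * S c u" by simp
      also have "\<dots> = P v * S v c * S c u" using S_sym[of v c] that assms by simp
      finally show ?thesis .
    qed
    then show ?thesis by (simp cong: sum.cong_simp)
  qed
  then show "R0 u v m m = 0"
    using assms by (simp add: R0_def mmul_def sum_distrib_left mult_ac sum_negf cong: sum.cong_simp)
qed (use assms in \<open>simp_all add: R0_def mmul_def cong: sum.cong_simp\<close>)

section \<open>Flat and Ricci-flat metrics for diagonal \<open>eta\<close>\<close>

lemma eps_nonzero: "eps \<noteq> 0" and P_nonzero: "i < m \<Longrightarrow> P i \<noteq> 0"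
  using eps_sq P_sq[of i] by auto

lemma flat_iff_Q_minors:
  "flat (Suc m) g \<longleftrightarrow> (\<forall>u<m. \<forall>v<m. Q u v = 0) \<and>
     (\<forall>u<m. \<forall>v<m. \<forall>w<m. \<forall>x<m. S w u * S x v = S w v * S x u)"
    (is "_ \<longleftrightarrow> ?Q \<and> ?minors")
proof -
  \<comment> \<open>Symmetry of \<open>P S\<close> lets the sign \<open>P w\<close> be factored out,
    leaving a minor of \<open>S\<close>.\<close>
  have minor: "P u * S u w * S x v - P v * S v w * S x u = P w * (S w u * S x v - S w v * S x u)"
    if "u < m" "v < m" "w < m" for u v w x
    using S_sym[of u w] S_sym[of v w] that by (simp add: algebra_simps)
  show ?thesis
  proof
    assume "flat (Suc m) g"
    then have R: "R0 a b i j = 0" if "a < Suc m" "b < Suc m" "i < Suc m" "j < Suc m" for a b i j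
      using that flat_iff by blast
    have ?Q using R R0_block_last by (metis less_Suc_eq)
    moreover have ?minors
    proof (intro allI impI)
      fix u v w x assume uvwx: "u < m" "v < m" "w < m" "x < m"
      then have "eps * (P w * (S w u * S x v - S w v * S x u)) = 0"
        using R[of u v x w] R0_block_block[of u v w x] by (simp add: minor)
      then show "S w u * S x v = S w v * S x u"
        using eps_nonzero P_nonzero uvwx by simp
    qed
    ultimately show "?Q \<and> ?minors" ..
  next
    assume QM: "?Q \<and> ?minors"
    have last: "R0 m v i j = 0" if "v < m" "i < Suc m" "j < Suc m" for v i j
      using that QM by (auto simp: less_Suc_eq R0_last_block R0_block_last)
    have block: "R0 u v i j = 0" if "u < m" "v < m" "i < Suc m" "j < Suc m" for u v i j
      using that QM by (auto simp: less_Suc_eq R0_block_block minor)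
    have "R0 a b i j = 0" if "a < Suc m" "b < Suc m" "i < Suc m" "j < Suc m" for a b i j
      using that last[of b i j] last[of a i j] block[of a b i j] R0_antisym[of a m i j] R0_self[of m i j]
      by (auto simp: less_Suc_eq)
    then show "flat (Suc m) g" using flat_iff by blast
  qed
qed

text \<open>The Ricci component with both arguments in the last direction is \<open>- tr Q\<close>,
  and the commutator in \<open>Q\<close> has trace zero.\<close>

lemma ricci_flat_trace:
  assumes "ricci_flat (Suc m) g"
  shows "(\<Sum>u<m. mmul m S S u u) = 0"
proof -
  have "(\<Sum>i<Suc m. R0 i m i m) = 0"
    using ricci_flat_origin[OF assms, of m m] by simp
  then have "(\<Sum>u<m. Q u u) = 0"
    using R0_antisym[of _ m] by (simp add: R0_self R0_block_last sum_negf cong: sum.cong_simp)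
  moreover have "(\<Sum>u<m. mmul m T S u u) = (\<Sum>u<m. mmul m S T u u)"
    unfolding mmul_def by (subst sum.swap) (simp add: mult.commute)
  ultimately show ?thesis
    by (simp add: Q_def sum_subtractf)
qed

text \<open>Ricci curvature inside the block: the contraction over the index \<open>m\<close> gives
  \<open>Q\<close>, the rest are contracted minors. It recovers \<open>Q = 0\<close> when
  \<open>S^2\<close> and \<open>(tr S) S\<close> vanish.\<close>

lemma ricci_flat_Q:
  assumes "ricci_flat (Suc m) g" "v < m" "w < m"
  shows "P v * Q v w = P w * mmul m S S w v - P v * S v w * (\<Sum>u<m. S u u)"
proof -
  have "(\<Sum>i<Suc m. R0 i v i w) = 0"
    using ricci_flat_origin[OF assms(1), of w v] assms by simp
  then have "(\<Sum>u<m. eps * (P u * S u w * S u v - P v * S v w * S u u)) - eps * (P v * Q v w) = 0"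
    using assms by (simp add: R0_last_block R0_block_block cong: sum.cong_simp)
  then have "eps * ((\<Sum>u<m. P u * S u w * S u v - P v * S v w * S u u) - P v * Q v w) = 0"
    by (simp add: sum_distrib_left right_diff_distrib)
  then have "P v * Q v w = (\<Sum>u<m. P u * S u w * S u v - P v * S v w * S u u)"
    using eps_nonzero by simp
  also have "\<dots> = (\<Sum>u<m. P w * S w u * S u v - P v * S v w * S u u)"
    using assms by (intro sum.cong refl) (simp add: S_sym)
  finally show ?thesis
    by (simp add: sum_subtractf mmul_def sum_distrib_left mult_ac)
qed

text \<open>With all signs of the block equal to \<open>1\<close>, \<open>S\<close> is symmetric and
  \<open>tr S^2\<close> is the sum of its squared entries. Ricci-flatness therefore forces
  \<open>S = 0\<close>, hence \<open>Q\<close> and all minors vanish.\<close>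

lemma flat_iff_riemannian_block:
  assumes "\<And>i. i < m \<Longrightarrow> P i = 1"
  shows "flat (Suc m) g \<longleftrightarrow> ricci_flat (Suc m) g"
proof
  assume R: "ricci_flat (Suc m) g"
  have "(\<Sum>u<m. \<Sum>c<m. (S u c)\<^sup>2) = (\<Sum>u<m. mmul m S S u u)"
    unfolding mmul_def using S_sym assms
    by (intro sum.cong refl) (simp add: power2_eq_square)
  then have "(\<Sum>u<m. \<Sum>c<m. (S u c)\<^sup>2) = 0" using ricci_flat_trace[OF R] by simp
  then have "S u c = 0" if "u < m" "c < m" for u c
    using that by (simp add: sum_nonneg_eq_0_iff sum_nonneg)
  then show "flat (Suc m) g"
    by (simp add: flat_iff_Q_minors Q_def mmul_def)
qed (rule flat_imp_ricci_flat)

lemma flat_iff_nilpotent_rank_one: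
  "flat (Suc m) g \<longleftrightarrow> ricci_flat (Suc m) g \<and> (\<forall>u<m. \<forall>v<m. mmul m S S u v = 0) \<and>
     (\<forall>u<m. \<forall>v<m. \<forall>w<m. \<forall>x<m. S w u * S x v = S w v * S x u)"
    (is "_ \<longleftrightarrow> _ \<and> ?nil \<and> ?minors")
proof -
  define tr where "tr = (\<Sum>u<m. S u u)"
  have sq: "mmul m S S x v = S x v * tr" if ?minors "x < m" "v < m" for x v
  proof -
    \<comment> \<open>A vanishing minor exchanges column indices:
      \<open>S x c * S c v = S x v * S c c\<close>.\<close>
    have "mmul m S S x v = (\<Sum>c<m. S x v * S c c)"
      unfolding mmul_def using that by (intro sum.cong refl) (metis lessThan_iff mult.commute)
    then show ?thesis by (simp add: sum_distrib_left tr_def)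
  qed
  show ?thesis
  proof
    assume f: "flat (Suc m) g"
    then have minors: ?minors and R: "ricci_flat (Suc m) g"
      using flat_iff_Q_minors flat_imp_ricci_flat by blast+
    \<comment> \<open>Taking the trace of \<open>S^2 = (tr S) S\<close> gives
      \<open>(tr S)^2 = tr S^2\<close>, which is zero by Ricci-flatness.\<close>
    have "tr * tr = (\<Sum>u<m. mmul m S S u u)"
      using sq[OF minors] by (simp add: tr_def sum_distrib_right)
    then have "tr = 0" using ricci_flat_trace[OF R] by simp
    then show "ricci_flat (Suc m) g \<and> ?nil \<and> ?minors"
      using R minors sq by simp
  next
    assume h: "ricci_flat (Suc m) g \<and> ?nil \<and> ?minors"
    \<comment> \<open>Of the two terms for \<open>P v * Q v w\<close>, the first contains
      \<open>S^2 = 0\<close>, and the second contains \<open>(tr S) S\<close>, which equals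
      \<open>S^2\<close> because the minors vanish.\<close>
    have "P v * Q v w = 0" if "v < m" "w < m" for v w
      using ricci_flat_Q[of v w] sq[of v w] h that by (simp add: tr_def)
    then show "flat (Suc m) g"
      using h P_nonzero by (simp add: flat_iff_Q_minors)
  qed
qed

end

section \<open>Null last coordinate\<close>

text \<open>The indices \<open>p\<close> and \<open>Suc p\<close> are those of the hyperbolic plane in \<open>eta\<close>.\<close>

locale exp_coframe_null = exp_coframe "Suc (Suc p)" eta Ah F H g for p eta Ah F H g +
  fixes S T :: "nat \<Rightarrow> nat \<Rightarrow> real" and b c :: "nat \<Rightarrow> real" and d :: real
  assumes eta_block: "\<And>i j. i < p \<Longrightarrow> eta i j = kron i j"
    and eta_null: "eta p p = 0" "eta p (Suc p) = 1" "eta (Suc p) (Suc p) = 0"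
    and Ah_block: "\<And>i j. i < p \<Longrightarrow> j < p \<Longrightarrow> Ah i j = S i j + T i j"
    and Ah_b: "\<And>i. i < p \<Longrightarrow> Ah i p = b i"
    and Ah_c: "\<And>j. j < p \<Longrightarrow> Ah p j = c j"
    and Ah_d: "Ah p p = d"
    and Ah_row [simp]: "\<And>j. Ah (Suc p) j = 0"
    and Ah_col [simp]: "\<And>i. Ah i (Suc p) = 0"
    and S_sym: "\<And>i j. i < p \<Longrightarrow> j < p \<Longrightarrow> S i j = S j i"
    and T_skew: "\<And>i j. i < p \<Longrightarrow> j < p \<Longrightarrow> T i j = - T j i"
begin

lemma kron_null [simp]:
  "kron (Suc p) (Suc p) = 1" "kron (Suc p) p = 0" "i < p \<Longrightarrow> kron (Suc p) i = 0"
  "i < p \<Longrightarrow> kron i (Suc p) = 0" "i < p \<Longrightarrow> kron i p = 0"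
  by (auto simp: kron_def)

lemma eta_values [simp]:
  "i < p \<Longrightarrow> eta i p = 0" "i < p \<Longrightarrow> eta i (Suc p) = 0" "i < p \<Longrightarrow> eta p i = 0"
  "i < p \<Longrightarrow> eta (Suc p) i = 0" "eta p p = 0" "eta p (Suc p) = 1" "eta (Suc p) p = 1"
  "eta (Suc p) (Suc p) = 0"
  using eta_sym[of p i] eta_sym[of "Suc p" i] eta_sym[of "Suc p" p] eta_null
  by (simp_all add: eta_block)

lemma mmul_eta_right [simp]:
  "j < p \<Longrightarrow> mmul (Suc (Suc p)) X eta i j = X i j"
  "mmul (Suc (Suc p)) X eta i p = X i (Suc p)"
  "mmul (Suc (Suc p)) X eta i (Suc p) = X i p"
  by (simp_all add: mmul_def eta_block sum_kron_right cong: sum.cong_simp)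

lemma mmul_eta_left [simp]:
  "i < p \<Longrightarrow> mmul (Suc (Suc p)) eta X i j = X i j"
  "mmul (Suc (Suc p)) eta X p j = X (Suc p) j"
  "mmul (Suc (Suc p)) eta X (Suc p) j = X p j"
  by (simp_all add: mmul_def eta_block sum_kron_left cong: sum.cong_simp)

lemma B_values:
  "u < p \<Longrightarrow> w < p \<Longrightarrow> B u w = 2 * S u w"
  "u < p \<Longrightarrow> B u p = b u" "u < p \<Longrightarrow> B p u = b u"
  "B p p = 0" "B p (Suc p) = d" "B (Suc p) p = d"
  "u < p \<Longrightarrow> B u (Suc p) = c u" "u < p \<Longrightarrow> B (Suc p) u = c u"
  "B (Suc p) (Suc p) = 0"
  using S_sym[of u w] T_skew[of u w]
  by (simp_all add: B_def mtransp_def Ah_block Ah_b Ah_c Ah_d)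

lemma M_values:
  "u < p \<Longrightarrow> w < p \<Longrightarrow> M u w = 2 * S u w"
  "u < p \<Longrightarrow> M u p = b u" "u < p \<Longrightarrow> M u (Suc p) = c u"
  "w < p \<Longrightarrow> M p w = c w" "M p p = d" "M p (Suc p) = 0"
  "w < p \<Longrightarrow> M (Suc p) w = b w" "M (Suc p) p = 0" "M (Suc p) (Suc p) = d"
  by (simp_all add: M_def B_values)

lemma D_block [simp]:
  assumes "u < p"
  shows "v < p \<Longrightarrow> w < p \<Longrightarrow> D u v w = 0" "w < p \<Longrightarrow> D u p w = S u w"
    "w < p \<Longrightarrow> D u (Suc p) w = 0" "v < p \<Longrightarrow> D u v p = 0" "D u p p = b u / 2"
    "D u (Suc p) p = 0" "v < p \<Longrightarrow> D u v (Suc p) = - S v u"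
    "D u p (Suc p) = 0" "D u (Suc p) (Suc p) = - b u / 2"
  using assms by (simp_all add: D_def M_values B_values)

lemma D_null [simp]:
  "v < p \<Longrightarrow> w < p \<Longrightarrow> D p v w = 0" "w < p \<Longrightarrow> D p p w = b w / 2"
  "w < p \<Longrightarrow> D p (Suc p) w = 0" "v < p \<Longrightarrow> D p v p = 0" "D p p p = 0" "D p (Suc p) p = 0"
  "v < p \<Longrightarrow> D p v (Suc p) = - b v / 2" "D p p (Suc p) = 0" "D p (Suc p) (Suc p) = 0"
  by (simp_all add: D_def M_values B_values)

lemma D_last [simp]:
  "v < p \<Longrightarrow> w < p \<Longrightarrow> D (Suc p) v w = - S v w" "w < p \<Longrightarrow> D (Suc p) p w = 0"
  "w < p \<Longrightarrow> D (Suc p) (Suc p) w = - b w / 2" "v < p \<Longrightarrow> D (Suc p) v p = - b v / 2"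
  "D (Suc p) p p = 0" "D (Suc p) (Suc p) p = 0" "v < p \<Longrightarrow> D (Suc p) v (Suc p) = - c v"
  "D (Suc p) p (Suc p) = 0" "D (Suc p) (Suc p) (Suc p) = - d"
  by (simp_all add: D_def M_values B_values)

lemmas Ah_values = Ah_block Ah_b Ah_c Ah_d

text \<open>The Ricci component in the two null directions is half the squared norm of
  \<open>b\<close>: up to a common sign the block indices contribute \<open>1/4\<close> of it and
  the index \<open>p\<close> contributes \<open>-3/4\<close>.\<close>

lemma ricci_flat_b:
  assumes R: "ricci_flat (Suc (Suc p)) g" and "i < p"
  shows "b i = 0"
proof -
  have "R0 (Suc p) u u p = (b u)\<^sup>2 / 4" if "u < p" for u
    using that by (simp add: R0_def rho_def mmul_def Ah_values power2_eq_square sum_negf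
        sum.distrib cong: sum.cong_simp)
  then have block: "(\<Sum>u<p. R0 (Suc p) u u p) = (\<Sum>u<p. (b u)\<^sup>2) / 4"
    unfolding sum_divide_distrib by (intro sum.cong) auto
  have null: "R0 (Suc p) p p p = - (3/4) * (\<Sum>u<p. (b u)\<^sup>2)"
    by (simp add: R0_def rho_def mmul_def Ah_values power2_eq_square sum_negf sum.distrib
        sum_divide_distrib[symmetric] cong: sum.cong_simp)
  have "(\<Sum>i<Suc (Suc p). R0 i (Suc p) i p) = 0"
    using ricci_flat_origin[OF R, of p "Suc p"] by simp
  then have "(\<Sum>u<p. R0 (Suc p) u u p) + R0 (Suc p) p p p = 0"
    using R0_antisym[of _ "Suc p"] by (simp add: R0_self sum_negf)
  then have "(\<Sum>u<p. (b u)\<^sup>2) = 0"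
    unfolding block null by simp
  then show ?thesis using \<open>i < p\<close> by (simp add: sum_nonneg_eq_0_iff)
qed

text \<open>Once \<open>b = 0\<close>, the null field \<open>\<partial>_p\<close> is parallel, as
  for a plane wave, and the remaining curvature consists of the
  \<open>R(\<partial>_(p+1), \<partial>_u)\<close>, whose entries are those of \<open>Q\<close> up
  to sign.\<close>

definition Q :: "nat \<Rightarrow> nat \<Rightarrow> real" where
  "Q u w = d * S u w - mmul p S S u w + (mmul p T S u w - mmul p S T u w)"

context
  assumes b_zero: "\<And>i. i < p \<Longrightarrow> b i = 0"
begin

lemma R0_block_block_null:
  assumes "u < p" "v < p" "i < Suc (Suc p)" "j < Suc (Suc p)"
  shows "R0 u v i j = 0"
proof -
  have "(\<Sum>a<p. S u a * S a v) = (\<Sum>a<p. S v a * S a u)"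
    using assms S_sym by (intro sum.cong refl) (simp add: mult.commute)
  then show ?thesis
    using assms b_zero by (auto simp: less_Suc_eq R0_def mmul_def sum_negf cong: sum.cong_simp)
qed

lemma R0_null_zero:
  assumes "u \<le> Suc p" "i < Suc (Suc p)" "j < Suc (Suc p)"
  shows "R0 u p i j = 0"
proof -
  \<comment> \<open>With \<open>D p = 0\<close>, also \<open>rho p = 0\<close>: in column
    \<open>p\<close> of \<open>Ah\<close> only the row \<open>p\<close> can be nonzero, and it
    multiplies \<open>D p\<close>.\<close>
  have D0: "D p i j = 0" if "i < Suc (Suc p)" "j < Suc (Suc p)" for i j
    using that b_zero by (auto simp: less_Suc_eq)
  have "u < p \<or> u = p \<or> u = Suc p" using assms(1) by linarith
  then show ?thesis
    using assms(2,3) D0 b_zero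
    by (auto simp: R0_def rho_def mmul_def Ah_values cong: sum.cong_simp)
qed

lemma R0_last_block_null:
  assumes "u < p"
  shows "w < p \<Longrightarrow> R0 (Suc p) u p w = Q u w" "v < p \<Longrightarrow> R0 (Suc p) u v (Suc p) = - Q v u"
    "v < p \<Longrightarrow> w < p \<Longrightarrow> R0 (Suc p) u v w = 0" "i < Suc (Suc p) \<Longrightarrow> R0 (Suc p) u i p = 0"
    "w < p \<Longrightarrow> R0 (Suc p) u (Suc p) w = 0"
    "R0 (Suc p) u p (Suc p) = 0" "R0 (Suc p) u (Suc p) (Suc p) = 0"
proof -
  assume w: "w < p"
  have "R0 (Suc p) u p w = d * S u w - (\<Sum>a<p. S u a * (S a w + T a w))
      - (\<Sum>a<p. (S a u + T a u) * S a w) + (\<Sum>a<p. S u a * S a w)"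
    using assms w b_zero
    by (simp add: R0_def rho_def mmul_def Ah_values sum_negf cong: sum.cong_simp)
  \<comment> \<open>Transposing \<open>A'\<close> keeps \<open>S\<close> and changes the sign of
    \<open>T\<close>, which produces the commutator in \<open>Q\<close>.\<close>
  also have "(\<Sum>a<p. (S a u + T a u) * S a w) = (\<Sum>a<p. (S u a - T u a) * S a w)"
    using assms S_sym T_skew by (intro sum.cong refl) (metis lessThan_iff uminus_add_conv_diff add.commute)
  finally show "R0 (Suc p) u p w = Q u w"
    by (simp add: Q_def mmul_def sum.distrib sum_subtractf algebra_simps)
next
  assume v: "v < p"
  have "R0 (Suc p) u v (Suc p) = - (\<Sum>a<p. (S v a + T v a) * S a u) + (\<Sum>a<p. (S a u + T a u) * S v a)
      + (\<Sum>a<p. S v a * S a u) - d * S v u"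
    using assms v b_zero
    by (simp add: R0_def rho_def mmul_def Ah_values sum_negf cong: sum.cong_simp)
  then show "R0 (Suc p) u v (Suc p) = - Q v u"
    by (simp add: Q_def mmul_def sum.distrib algebra_simps)
next
  \<comment> \<open>By symmetry of \<open>S\<close> the two contractions with \<open>c\<close>
    cancel in this component.\<close>
  have "(\<Sum>a<p. c a * S a u) = (\<Sum>a<p. S u a * c a)"
    using assms S_sym by (intro sum.cong refl) (simp add: mult.commute)
  then show "R0 (Suc p) u p (Suc p) = 0"
    using assms b_zero
    by (simp add: R0_def rho_def mmul_def Ah_values sum_negf cong: sum.cong_simp)
qed (use assms b_zero in \<open>auto simp: less_Suc_eq R0_def rho_def mmul_def Ah_values cong: sum.cong_simp\<close>)

lemma flat_iff_Q: "flat (Suc (Suc p)) g \<longleftrightarrow> (\<forall>u<p. \<forall>w<p. Q u w = 0)"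
proof
  assume "flat (Suc (Suc p)) g"
  then have "R0 (Suc p) u p w = 0" if "u < p" "w < p" for u w
    using that flat_iff by simp
  then show "\<forall>u<p. \<forall>w<p. Q u w = 0" by (simp add: R0_last_block_null)
next
  assume Q: "\<forall>u<p. \<forall>w<p. Q u w = 0"
  have last: "R0 (Suc p) u i j = 0" if "u < Suc p" "i < Suc (Suc p)" "j < Suc (Suc p)" for u i j
    using that R0_null_zero[of "Suc p" i j] Q by (auto simp: less_Suc_eq R0_last_block_null)
  have "R0 u v i j = 0" if "u < Suc (Suc p)" "v < Suc (Suc p)" "i < Suc (Suc p)" "j < Suc (Suc p)"
    for u v i j
  proof -
    consider "u = Suc p" "v = Suc p" | "u = Suc p" "v < Suc p" | "u < Suc p" "v = Suc p"
      | "v = p" "u < Suc p" | "u = p" "v < p" | "u < p" "v < p"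
      using \<open>u < _\<close> \<open>v < _\<close> by linarith
    then show ?thesis
      using that last[of v i j] last[of u i j] R0_antisym[of u "Suc p" i j] R0_antisym[of p v i j]
        R0_null_zero[of u i j] R0_null_zero[of v i j] R0_block_block_null[of u v i j]
      by cases (simp_all add: R0_self)
  qed
  then show "flat (Suc (Suc p)) g" using flat_iff by simp
qed

text \<open>The Ricci component with both arguments in the last direction is \<open>tr Q\<close>,
  where the commutator contributes nothing.\<close>

lemma ricci_flat_trace_Q:
  assumes "ricci_flat (Suc (Suc p)) g"
  shows "d * (\<Sum>u<p. S u u) = (\<Sum>u<p. mmul p S S u u)"
proof -
  have "(\<Sum>i<Suc (Suc p). R0 i (Suc p) i (Suc p)) = 0"
    using ricci_flat_origin[OF assms, of "Suc p" "Suc p"] by simp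
  moreover have "R0 (Suc p) p p (Suc p) = 0"
    by (rule R0_null_zero) auto
  ultimately have "(\<Sum>u<p. Q u u) = 0"
    using R0_antisym[of _ "Suc p"]
    by (simp add: R0_self R0_last_block_null sum_negf cong: sum.cong_simp)
  moreover have "(\<Sum>u<p. mmul p T S u u) = (\<Sum>u<p. mmul p S T u u)"
    unfolding mmul_def by (subst sum.swap) (simp add: mult.commute)
  ultimately show ?thesis
    by (simp add: Q_def sum.distrib sum_subtractf sum_distrib_left)
qed

end

text \<open>For \<open>d = 0\<close> the trace condition reads \<open>tr S^2 = 0\<close> with
  \<open>S\<close> symmetric, so \<open>S = 0\<close> and \<open>Q = 0\<close>.\<close>

lemma flat_iff_ricci_flat:
  assumes "d = 0"
  shows "flat (Suc (Suc p)) g \<longleftrightarrow> ricci_flat (Suc (Suc p)) g"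
proof
  assume R: "ricci_flat (Suc (Suc p)) g"
  have "(\<Sum>u<p. \<Sum>a<p. (S u a)\<^sup>2) = (\<Sum>u<p. mmul p S S u u)"
    unfolding mmul_def using S_sym
    by (intro sum.cong refl) (metis lessThan_iff power2_eq_square)
  then have "(\<Sum>u<p. \<Sum>a<p. (S u a)\<^sup>2) = 0"
    using ricci_flat_trace_Q[OF ricci_flat_b[OF R] R] assms by simp
  then have "S u a = 0" if "u < p" "a < p" for u a
    using that by (simp add: sum_nonneg_eq_0_iff sum_nonneg)
  then show "flat (Suc (Suc p)) g"
    by (simp add: flat_iff_Q[OF ricci_flat_b[OF R]] Q_def mmul_def)
qed (rule flat_imp_ricci_flat)

text \<open>From right to left, Ricci-flatness supplies \<open>b = 0\<close> and the two matrix
  identities make \<open>Q\<close> vanish. From left to right, \<open>Q = 0\<close> has to be split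
  into its symmetric polynomial part and its commutator part.\<close>

lemma flat_iff_projection:
  assumes "d = 1"
  shows "flat (Suc (Suc p)) g \<longleftrightarrow> ricci_flat (Suc (Suc p)) g \<and>
    (\<forall>u<p. \<forall>w<p. S u w = mmul p S S u w) \<and> (\<forall>u<p. \<forall>w<p. mmul p S T u w = mmul p T S u w)"
proof
  assume h: "ricci_flat (Suc (Suc p)) g \<and>
    (\<forall>u<p. \<forall>w<p. S u w = mmul p S S u w) \<and> (\<forall>u<p. \<forall>w<p. mmul p S T u w = mmul p T S u w)"
  then have b: "b i = 0" if "i < p" for i using that ricci_flat_b by blast
  show "flat (Suc (Suc p)) g"
    unfolding flat_iff_Q[OF b, simplified]
  proof (intro allI impI)
    fix u w assume "u < p" "w < p"
    then show "Q u w = 0"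
      unfolding Q_def using h assms by simp
  qed
next
  assume f: "flat (Suc (Suc p)) g"
  then have R: "ricci_flat (Suc (Suc p)) g" by (rule flat_imp_ricci_flat)
  define X where "X u w = S u w - mmul p S S u w" for u w
  define SX where "SX = mmul p S X"
  have Q: "X u w = mmul p S T u w - mmul p T S u w" if "u < p" "w < p" for u w
  proof -
    have "Q u w = 0" using f that flat_iff_Q[OF ricci_flat_b[OF R]] by simp
    then show ?thesis unfolding Q_def X_def using assms by simp
  qed
  have SS: "mmul p S S u w = mmul p S S w u" if "u < p" "w < p" for u w
    unfolding mmul_def using S_sym that by (intro sum.cong refl) (simp add: mult.commute)
  have X_sym: "X u w = X w u" if "u < p" "w < p" for u w
    using that S_sym SS by (simp add: X_def)
  have trace_comm: "(\<Sum>u<p. mmul p Y Z u u) = (\<Sum>u<p. mmul p Z Y u u)" for Y Z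
    unfolding mmul_def by (subst sum.swap) (simp add: mult.commute)
  have comm: "mmul p X S = mmul p S X"
    by (intro ext) (simp add: X_def[abs_def] mmul_diff_left mmul_diff_right mmul_assoc)
  \<comment> \<open>\<open>X\<close> is a polynomial in \<open>S\<close>, so the trace of \<open>X\<^sup>2 = X [S, T]\<close> vanishes.\<close>
  have "(\<Sum>u<p. \<Sum>a<p. (X u a)\<^sup>2) = (\<Sum>u<p. mmul p X X u u)"
    unfolding mmul_def using X_sym
    by (intro sum.cong refl) (metis lessThan_iff power2_eq_square)
  also have "\<dots> = (\<Sum>u<p. mmul p X (\<lambda>u w. mmul p S T u w - mmul p T S u w) u u)"
    by (intro sum.cong refl mmul_cong) (auto simp: Q)
  also have "\<dots> = (\<Sum>u<p. mmul p (mmul p X S) T u u) - (\<Sum>u<p. mmul p (mmul p X T) S u u)"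
    by (simp add: mmul_diff_right sum_subtractf mmul_assoc)
  also have "\<dots> = 0"
    unfolding trace_comm[of "mmul p X T"] comm by (simp add: mmul_assoc)
  finally have "X u a = 0" if "u < p" "a < p" for u a
    using that by (simp add: sum_nonneg_eq_0_iff sum_nonneg)
  then show "ricci_flat (Suc (Suc p)) g \<and>
    (\<forall>u<p. \<forall>w<p. S u w = mmul p S S u w) \<and> (\<forall>u<p. \<forall>w<p. mmul p S T u w = mmul p T S u w)"
    using R Q by (simp add: X_def)
qed

end

section \<open>The three families of metrics\<close>

lemma mmul_kron_diag:
  assumes "i < n" "j < n" "\<And>i. i < n \<Longrightarrow> s i * s i = 1"
  shows "mmul n (\<lambda>i j. kron i j * s i) (\<lambda>i j. kron i j * s i) i j = kron i j"
proof -
  have "mmul n (\<lambda>i j. kron i j * s i) (\<lambda>i j. kron i j * s i) i j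
      = (\<Sum>c<n. kron i c * (s i * (kron c j * s c)))"
    by (simp add: mmul_def mult_ac)
  then show ?thesis
    using assms by (simp add: sum_kron_left)
qed

lemma exp_coframe_diag_almost_abelian:
  fixes P :: "nat \<Rightarrow> real" and eps :: real
  assumes A: "A \<in> carrier_mat m m" "S \<in> carrier_mat m m" "T \<in> carrier_mat m m" "A = S + T"
    and P: "\<And>i. i < m \<Longrightarrow> P i * P i = 1" and eps: "eps * eps = 1"
    and S: "\<And>i j. i < m \<Longrightarrow> j < m \<Longrightarrow> P i * S $$ (i, j) = P j * S $$ (j, i)"
    and T: "\<And>i j. i < m \<Longrightarrow> j < m \<Longrightarrow> P i * T $$ (i, j) = - (P j * T $$ (j, i))"
  shows "exp_coframe_diag m (\<lambda>i j. kron i j * (if i < m then P i else eps))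
    (\<lambda>i j. if i < m \<and> j < m then A $$ (i, j) else 0) (coframe m A) (\<lambda>t. coframe m A (- t))
    (almost_abelian_metric (Suc m) A (mat_diag (Suc m) (\<lambda>i. if i < m then P i else eps)))
    (\<lambda>i j. S $$ (i, j)) (\<lambda>i j. T $$ (i, j)) P eps"
proof (intro exp_coframe_diag.intro exp_coframe_almost_abelian exp_coframe_diag_axioms.intro)
  show "A \<in> carrier_mat m m" by (rule A)
  show "mat_diag (Suc m) (\<lambda>i. if i < m then P i else eps) \<in> carrier_mat (Suc m) (Suc m)"
    by (simp add: mat_diag_def)
next
  fix i j assume ij: "i < Suc m" "j < Suc m"
  show "mat_diag (Suc m) (\<lambda>i. if i < m then P i else eps) $$ (i, j)
      = kron i j * (if i < m then P i else eps)"
    using ij by (simp add: mat_diag_def kron_def)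
  show "mmul (Suc m) (\<lambda>i j. kron i j * (if i < m then P i else eps))
      (\<lambda>i j. kron i j * (if i < m then P i else eps)) i j = kron i j"
    using ij P eps by (intro mmul_kron_diag) auto
qed (auto simp: kron_def A(4) carrier_matD[OF A(3)] P eps intro: S T)

text \<open>The function standing for \<open>eta_c\<close> is chosen symmetric for all pairs of
  indices, as \<open>eta_sym\<close> has no index bounds; the entries of \<open>Ah\<close> are read
  off from the bordered matrix.\<close>

lemma exp_coframe_null_almost_abelian:
  assumes A': "A' \<in> carrier_mat p p" "S \<in> carrier_mat p p" "T \<in> carrier_mat p p" "A' = S + T"
    and b: "b \<in> carrier_vec p" and c: "c \<in> carrier_vec p"
    and S: "\<And>i j. i < p \<Longrightarrow> j < p \<Longrightarrow> S $$ (i, j) = S $$ (j, i)"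
    and T: "\<And>i j. i < p \<Longrightarrow> j < p \<Longrightarrow> T $$ (i, j) = - T $$ (j, i)"
    and A: "A = bordered_mat p A' b c d"
  shows "exp_coframe_null p
    (\<lambda>i j. if i < p \<or> j < p then kron i j else if i = j then 0 else 1)
    (\<lambda>i j. if i < Suc p \<and> j < Suc p then A $$ (i, j) else 0)
    (coframe (Suc p) A) (\<lambda>t. coframe (Suc p) A (- t))
    (almost_abelian_metric (Suc (Suc p)) A (eta_c (Suc (Suc p))))
    (\<lambda>i j. S $$ (i, j)) (\<lambda>i j. T $$ (i, j)) (\<lambda>i. b $ i) (\<lambda>i. c $ i) d"
proof (intro exp_coframe_null.intro exp_coframe_almost_abelian exp_coframe_null_axioms.intro)
  show "A \<in> carrier_mat (Suc p) (Suc p)"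
    using A'(1) by (auto simp: A bordered_mat_def mat_of_rows_list_def)
  show "eta_c (Suc (Suc p)) \<in> carrier_mat (Suc (Suc p)) (Suc (Suc p))"
    by (auto simp: eta_c_def mat_of_rows_list_def)
next
  fix i j assume ij: "i < Suc (Suc p)" "j < Suc (Suc p)"
  show "eta_c (Suc (Suc p)) $$ (i, j)
      = (if i < p \<or> j < p then kron i j else if i = j then 0 else 1)"
    using ij by (auto simp: eta_c_def mat_of_rows_list_def kron_def less_Suc_eq)
  show "mmul (Suc (Suc p)) (\<lambda>i j. if i < p \<or> j < p then kron i j else if i = j then 0 else 1)
      (\<lambda>i j. if i < p \<or> j < p then kron i j else if i = j then 0 else 1) i j = kron i j"
  proof (cases "i < p")
    case True
    then show ?thesis
      using ij by (cases "j < p")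
        (auto simp: mmul_def sum_kron_left kron_def[of _ p] kron_def[of _ "Suc p"] less_Suc_eq
          cong: sum.cong_simp)
  next
    case False
    then show ?thesis
      using ij by (auto simp: mmul_def kron_def less_Suc_eq cong: sum.cong_simp)
  qed
qed (use b c in \<open>auto simp: A A'(4) carrier_matD[OF A'(2)] carrier_matD[OF A'(3)] bordered_mat_def
    mat_of_rows_list_def mat_of_cols_def mat_of_rows_def kron_def intro: S T\<close>)

section \<open>Entrywise form of the decompositions\<close>

lemma sym_skew_decomp_entries:
  assumes "sym_skew_decomp m A S T"
  shows "S \<in> carrier_mat m m" "T \<in> carrier_mat m m" "A = S + T"
    "i < m \<Longrightarrow> j < m \<Longrightarrow> S $$ (i, j) = S $$ (j, i)"
    "i < m \<Longrightarrow> j < m \<Longrightarrow> T $$ (i, j) = - T $$ (j, i)"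
proof -
  show S: "S \<in> carrier_mat m m" and T: "T \<in> carrier_mat m m" and "A = S + T"
    using assms by (auto simp: sym_skew_decomp_def)
  assume ij: "i < m" "j < m"
  have "transpose_mat S $$ (j, i) = S $$ (j, i)" "transpose_mat T $$ (j, i) = (- T) $$ (j, i)"
    using assms by (simp_all add: sym_skew_decomp_def)
  then show "S $$ (i, j) = S $$ (j, i)" "T $$ (i, j) = - T $$ (j, i)"
    using S T ij by auto
qed

text \<open>Conjugation by the diagonal sign matrix multiplies an entry by \<open>s j * s i\<close>.
  Since signs square to \<open>1\<close>, one of them moves to the other side, giving adjointness
  for the form with diagonal \<open>s\<close>.\<close>

lemma lorentz_decomp_entries:
  fixes m :: nat
  defines "s \<equiv> \<lambda>i :: nat. if i = 0 then - 1 else 1 :: real"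
  assumes "lorentz_decomp m A S T"
  shows "S \<in> carrier_mat m m" "T \<in> carrier_mat m m" "A = S + T"
    "i < m \<Longrightarrow> j < m \<Longrightarrow> s i * S $$ (i, j) = s j * S $$ (j, i)"
    "i < m \<Longrightarrow> j < m \<Longrightarrow> s i * T $$ (i, j) = - (s j * T $$ (j, i))"
proof -
  show S: "S \<in> carrier_mat m m" and T: "T \<in> carrier_mat m m" and "A = S + T"
    using assms by (auto simp: lorentz_decomp_def)
  assume ij: "i < m" "j < m"
  have J: "(lorentz_J m * X * lorentz_J m) $$ (j, i) = s j * X $$ (j, i) * s i"
    if "X \<in> carrier_mat m m" for X
    using that ij unfolding lorentz_J_def s_def
    by (subst mat_diag_mult_left[of _ m m], simp, subst mat_diag_mult_right[of _ m m]) auto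
  have "transpose_mat S $$ (j, i) = s j * S $$ (j, i) * s i"
    using assms J[OF S] by (simp add: lorentz_decomp_def)
  moreover have "transpose_mat T $$ (j, i) = - (s j * T $$ (j, i) * s i)"
    using assms J[OF T] ij T by (simp add: lorentz_decomp_def lorentz_J_def mat_diag_def)
  moreover have "s i * s i = 1" by (simp add: s_def)
  ultimately show "s i * S $$ (i, j) = s j * S $$ (j, i)" "s i * T $$ (i, j) = - (s j * T $$ (j, i))"
    using S T ij by (simp_all add: mult_ac)
qed

section \<open>The equivalences for the three families\<close>

lemma flat_iff_case_a:
  assumes "A \<in> carrier_mat m m" "sym_skew_decomp m A S T"
  shows "flat (Suc m) (almost_abelian_metric (Suc m) A (eta_a (Suc m))) \<longleftrightarrow>
    ricci_flat (Suc m) (almost_abelian_metric (Suc m) A (eta_a (Suc m)))"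
proof -
  note dec = sym_skew_decomp_entries[OF assms(2)]
  have eta: "eta_a (Suc m) = mat_diag (Suc m) (\<lambda>i. if i < m then 1 else - 1)"
    by (auto simp: eta_a_def mat_diag_def)
  show ?thesis
    unfolding eta
    by (rule exp_coframe_diag.flat_iff_riemannian_block[OF exp_coframe_diag_almost_abelian
        [OF assms(1) dec(1-3), where P = "\<lambda>_. 1"]]) (auto intro: dec(4,5))
qed

lemma flat_iff_case_b:
  assumes "0 < m" "A \<in> carrier_mat m m" "lorentz_decomp m A S T"
  shows "flat (Suc m) (almost_abelian_metric (Suc m) A (eta_b (Suc m))) \<longleftrightarrow>
    ricci_flat (Suc m) (almost_abelian_metric (Suc m) A (eta_b (Suc m))) \<and>
    S * S = 0\<^sub>m m m \<and> vec_space.rank m S \<le> 1"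
proof -
  note dec = lorentz_decomp_entries[OF assms(3)]
  \<comment> \<open>As \<open>0 < m\<close>, the negative direction lies inside the block:
    \<open>P\<close> is \<open>-1\<close> at index \<open>0\<close> and \<open>1\<close> elsewhere,
    while \<open>eps = 1\<close>.\<close>
  have eta: "eta_b (Suc m) = mat_diag (Suc m) (\<lambda>i. if i < m then if i = 0 then - 1 else 1 else 1)"
    using assms(1) by (auto simp: eta_b_def mat_diag_def)
  have "flat (Suc m) (almost_abelian_metric (Suc m) A (eta_b (Suc m))) \<longleftrightarrow>
    ricci_flat (Suc m) (almost_abelian_metric (Suc m) A (eta_b (Suc m))) \<and>
    (\<forall>u<m. \<forall>v<m. mmul m (\<lambda>i j. S $$ (i, j)) (\<lambda>i j. S $$ (i, j)) u v = 0) \<and>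
    (\<forall>u<m. \<forall>v<m. \<forall>w<m. \<forall>x<m. S $$ (w, u) * S $$ (x, v) = S $$ (w, v) * S $$ (x, u))"
    unfolding eta
    by (rule exp_coframe_diag.flat_iff_nilpotent_rank_one[OF exp_coframe_diag_almost_abelian
        [OF assms(2) dec(1-3)]]) (rule dec(4,5) | simp)+
  moreover have "S * S = 0\<^sub>m m m \<longleftrightarrow>
      (\<forall>u<m. \<forall>v<m. mmul m (\<lambda>i j. S $$ (i, j)) (\<lambda>i j. S $$ (i, j)) u v = 0)"
    using dec(1) by (auto simp: mat_eq_iff mat_mult_entry[symmetric] simp del: index_mult_mat(1))
  moreover have "vec_space.rank m S \<le> 1 \<longleftrightarrow>
      (\<forall>u<m. \<forall>v<m. \<forall>w<m. \<forall>x<m. S $$ (w, u) * S $$ (x, v) = S $$ (w, v) * S $$ (x, u))"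
    unfolding vec_space.rank_le_1_iff[OF dec(1)] by blast
  ultimately show ?thesis by simp
qed

lemma flat_iff_case_c:
  assumes "A' \<in> carrier_mat p p" "b \<in> carrier_vec p" "c \<in> carrier_vec p"
    and "A = bordered_mat p A' b c d" "sym_skew_decomp p A' S T"
  defines "g \<equiv> almost_abelian_metric (Suc (Suc p)) A (eta_c (Suc (Suc p)))"
  shows "d = 0 \<Longrightarrow> flat (Suc (Suc p)) g \<longleftrightarrow> ricci_flat (Suc (Suc p)) g"
    and "d = 1 \<Longrightarrow> flat (Suc (Suc p)) g \<longleftrightarrow>
      ricci_flat (Suc (Suc p)) g \<and> S = S * S \<and> commutator_mat S T = 0\<^sub>m p p"
proof -
  note dec = sym_skew_decomp_entries[OF assms(5)]
  interpret exp_coframe_null p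
    "\<lambda>i j. if i < p \<or> j < p then kron i j else if i = j then 0 else 1"
    "\<lambda>i j. if i < Suc p \<and> j < Suc p then A $$ (i, j) else 0"
    "coframe (Suc p) A" "\<lambda>t. coframe (Suc p) A (- t)" g
    "\<lambda>i j. S $$ (i, j)" "\<lambda>i j. T $$ (i, j)" "\<lambda>i. b $ i" "\<lambda>i. c $ i" d
    unfolding g_def by (rule exp_coframe_null_almost_abelian[OF assms(1) dec(1-3) assms(2,3) dec(4,5) assms(4)])
  show "d = 0 \<Longrightarrow> flat (Suc (Suc p)) g \<longleftrightarrow> ricci_flat (Suc (Suc p)) g"
    by (rule flat_iff_ricci_flat)
  have "S = S * S \<longleftrightarrow>
      (\<forall>u<p. \<forall>w<p. S $$ (u, w) = mmul p (\<lambda>i j. S $$ (i, j)) (\<lambda>i j. S $$ (i, j)) u w)"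
    using dec(1) mat_mult_entry[OF dec(1,1)]
    by (auto simp: mat_eq_iff simp del: index_mult_mat(1))
  moreover have "commutator_mat S T = 0\<^sub>m p p \<longleftrightarrow>
      (\<forall>u<p. \<forall>w<p. mmul p (\<lambda>i j. S $$ (i, j)) (\<lambda>i j. T $$ (i, j)) u w
        = mmul p (\<lambda>i j. T $$ (i, j)) (\<lambda>i j. S $$ (i, j)) u w)"
    using dec(1,2) mat_mult_entry[OF dec(1,2)] mat_mult_entry[OF dec(2,1)]
    by (auto simp: commutator_mat_def mat_eq_iff simp del: index_mult_mat(1))
  ultimately show "d = 1 \<Longrightarrow> flat (Suc (Suc p)) g \<longleftrightarrow>
      ricci_flat (Suc (Suc p)) g \<and> S = S * S \<and> commutator_mat S T = 0\<^sub>m p p"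
    using flat_iff_projection by simp
qed

theorem proposition3p6:
  fixes n :: nat and A :: "real mat"
  assumes "n \<ge> 2" and "A \<in> carrier_mat (n - 1) (n - 1)"
  shows
    "(\<forall>S T. sym_skew_decomp (n - 1) A S T \<longrightarrow>
        (flat n (almost_abelian_metric n A (eta_a n)) \<longleftrightarrow>
         ricci_flat n (almost_abelian_metric n A (eta_a n))))
     \<and>
     (\<forall>S T. lorentz_decomp (n - 1) A S T \<longrightarrow>
        (flat n (almost_abelian_metric n A (eta_b n)) \<longleftrightarrow>
         ricci_flat n (almost_abelian_metric n A (eta_b n)) \<and>
         S * S = 0\<^sub>m (n - 1) (n - 1) \<and> vec_space.rank (n - 1) S \<le> 1))
     \<and>
     (\<forall>A' b c d S' T'.
        A' \<in> carrier_mat (n - 2) (n - 2) \<and> b \<in> carrier_vec (n - 2) \<and> c \<in> carrier_vec (n - 2) \<and>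
        A = bordered_mat (n - 2) A' b c d \<and> sym_skew_decomp (n - 2) A' S' T' \<longrightarrow>
        (d = 0 \<longrightarrow>
          (flat n (almost_abelian_metric n A (eta_c n)) \<longleftrightarrow>
           ricci_flat n (almost_abelian_metric n A (eta_c n)))) \<and>
        (d = 1 \<longrightarrow>
          (flat n (almost_abelian_metric n A (eta_c n)) \<longleftrightarrow>
           ricci_flat n (almost_abelian_metric n A (eta_c n)) \<and>
           S' = S' * S' \<and> commutator_mat S' T' = 0\<^sub>m (n - 2) (n - 2))))"
proof -
  \<comment> \<open>The size is used in two forms: a block of size \<open>m\<close> and one further
    coordinate in cases (a) and (b), a block of size \<open>p\<close> and a hyperbolic plane in case
    (c).\<close>
  obtain m where n: "n = Suc m" and m: "0 < m"
    using assms(1) by (cases n) auto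
  obtain p where p: "n = Suc (Suc p)"
    using n m by (cases m) auto
  have A: "A \<in> carrier_mat m m" using assms(2) n by simp
  show ?thesis
  proof (intro conjI)
    show "\<forall>S T. sym_skew_decomp (n - 1) A S T \<longrightarrow>
        (flat n (almost_abelian_metric n A (eta_a n)) \<longleftrightarrow>
         ricci_flat n (almost_abelian_metric n A (eta_a n)))"
      using flat_iff_case_a[OF A] n by simp
    show "\<forall>S T. lorentz_decomp (n - 1) A S T \<longrightarrow>
        (flat n (almost_abelian_metric n A (eta_b n)) \<longleftrightarrow>
         ricci_flat n (almost_abelian_metric n A (eta_b n)) \<and>
         S * S = 0\<^sub>m (n - 1) (n - 1) \<and> vec_space.rank (n - 1) S \<le> 1)"
      using flat_iff_case_b[OF m A] n by simp
    have np: "n - 2 = p" using p by simp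
    show "\<forall>A' b c d S' T'.
        A' \<in> carrier_mat (n - 2) (n - 2) \<and> b \<in> carrier_vec (n - 2) \<and> c \<in> carrier_vec (n - 2) \<and>
        A = bordered_mat (n - 2) A' b c d \<and> sym_skew_decomp (n - 2) A' S' T' \<longrightarrow>
        (d = 0 \<longrightarrow>
          (flat n (almost_abelian_metric n A (eta_c n)) \<longleftrightarrow>
           ricci_flat n (almost_abelian_metric n A (eta_c n)))) \<and>
        (d = 1 \<longrightarrow>
          (flat n (almost_abelian_metric n A (eta_c n)) \<longleftrightarrow>
           ricci_flat n (almost_abelian_metric n A (eta_c n)) \<and>
           S' = S' * S' \<and> commutator_mat S' T' = 0\<^sub>m (n - 2) (n - 2)))"
      unfolding np unfolding p
      by (intro allI impI; elim conjE; intro conjI impI) (rule flat_iff_case_c; assumption)+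
  qed
qed

end
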